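(* Let $G=(X,w,\kappa,\mu)$ be a connected graph and $1\le p<\infty$. If $p>1$, assume that $\sum_{y\in X}\frac{w(x,y)^p}{\mu(y)^{p-1}}<\infty$ for every $x\in X$. Let $f:\mathbb R\to\mathbb R$ satisfy (F1) or (F2). Then there exists a dense subset $\Omega_p\subseteq\operatorname{dom}_p(\mathcal A)$ such that: - if (F1) holds, then $\mathcal A_{|\Omega_p}$ is accretive on $\ell^p(X,\mu)$; - if (F2) holds with constant $L>0$, then $\mathcal A_{|\Omega_p}$ is $\omega$-accretive on $\ell^p(X,\mu)$ with $\omega=L$. Moreover: (I) If (F1) holds, then for every $\lambda>0$ and every $g\in\ell^{p,\pm}(X,\mu)$ there exists a unique solution $u$ of $$(\operatorname{id}+\lambda\mathcal A)u=g\quad\text{in }X$$ satisfying $u\in\ell^{p,\pm}(X,\mu)\cap\Omega_p$ (with the same sign as for $g$) and the estimate $\|u\|_p\le C\|g\|_p$ with $C=1$. If (F2) holds with constant $L>0$, then for every $\lambda\in(0,1/L)$ and every $g\in\ell^{p,\pm}(X,\mu)$ there exists a unique solution $u$ of the same equation satisfying $u\in\ell^{p,\pm}(X,\mu)\cap\Omega_p$ and the estimate $\|u\|_p\le C\|g\|_p$ with $C=(1-\lambda L)^{-1}$. (II) If $G$ satisfies condition (IP) or condition (B), then $\Omega_p=\operatorname{dom}_p(\mathcal A)$, and for every $g\in\ell^p(X,\mu)$ (and every $\lambda>0$ if (F1) holds, respectively every $\lambda\in(0,1/L)$ if (F2) holds) there exists a unique solution $u\in\Omega_p$ of $(\operatorname{id}+\lambda\mathcal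 A)u=g$ in $X$, and it satisfies $\|u\|_p\le 2^{(p-1)/p}C\|g\|_p$, with $C=1$ if (F1) holds, respectively $C=(1-\lambda L)^{-1}$ if (F2) holds.
   Context: A graph $G=(X,w,\kappa,\mu)$ consists of a countable set $X$ (nodes), an edge-weight $w:X\times X\to[0,\infty)$ with $w(x,y)=w(y,x)$, $w(x,x)=0$ and $\sum_{y\in X}w(x,y)<\infty$ for all $x,y\in X$, a killing term $\kappa:X\to[0,\infty)$, and a node measure $\mu:X\to(0,\infty)$. Write $x\sim y$ iff $w(x,y)>0$. A walk is a (possibly infinite) sequence of nodes $\{x_i\}_{i\ge0}$ with $x_i\sim x_{i+1}$; a path is a walk with no repeated nodes; $G$ is connected if any two nodes are joined by a finite walk. (IP): for every infinite path $\{x_n\}_n$, $\sum_n\mu(x_n)=\infty$. (B): $\sup_{x\in X}\frac{\sum_{y\in X}w(x,y)}{\mu(x)}<\infty$. (F1): $f$ is continuous and monotone decreasing with $f(0)=0$. (F2): $f$ is uniformly Lipschitz with constant $L>0$ and $f(0)=0$. $C(X)$ is the set of real functions on $X$; $\ell^p(X,\mu)=\{u\in C(X):\sum_x|u(x)|^p\mu(x)<\infty\}$ with norm $\|u\|_p=(\sum_x|u(x)|^p\mu(x))^{1/p}$; $\ell^{p,+}(X,\mu)=\{u\in\ell^p(X,\mu):u\ge0\}$ and $\ell^{p,-}(X,\mu)=-\ell^{p,+}(X,\mu)$. The formal graph Laplacian $\Delta$ has domain $\operatorname{dom}(\Delta)=\{u\in C(X):\sum_{y}w(x,y)|u(y)|<\infty\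 \forall x\in X\}$ and acts by $$\Delta u(x)=\frac1{\mu(x)}\sum_{y\in X}w(x,y)(u(x)-u(y))+\frac{\kappa(x)}{\mu(x)}u(x).$$ Set $(Fu)(x)=-f(u(x))$, $\mathcal A=F+\Delta$ and $\operatorname{dom}_p(\mathcal A)=\{u\in\ell^p(X,\mu): u\in\operatorname{dom}(\Delta),\ \mathcal Au\in\ell^p(X,\mu)\}$. Density is with respect to $\|\cdot\|_p$. A (not necessarily linear) operator $\mathcal B:\operatorname{dom}(\mathcal B)\subseteq E\to E$ on a real Banach space $E$ is accretive if $\|(u-v)+\lambda(\mathcal Bu-\mathcal Bv)\|\ge\|u-v\|$ for all $u,v\in\operatorname{dom}(\mathcal B)$ and all $\lambda>0$; it is $\omega$-accretive ($\omega\in\mathbb R$) if $\mathcal B+\omega\operatorname{id}$ is accretive. *)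

theory Defs
  imports "HOL-Analysis.Analysis"
begin

section \<open>Weighted graphs\<close>

text \<open>The node set is the whole (countable) type. All sums over nodes are unconditional sums
  (\<open>summable_on\<close>, \<open>infsum\<close>).\<close>

locale weighted_graph =
  fixes w :: "'a::countable \<Rightarrow> 'a \<Rightarrow> real"
    and \<kappa> :: "'a \<Rightarrow> real"
    and \<mu> :: "'a \<Rightarrow> real"
  assumes w_nonneg: "w x y \<ge> 0"
    and w_sym: "w x y = w y x"
    and w_irrefl: "w x x = 0"
    and w_summable: "w x summable_on UNIV"
    and \<kappa>_nonneg: "\<kappa> x \<ge> 0"
    and \<mu>_pos: "\<mu> x > 0"

definition adj :: "('a \<Rightarrow> 'a \<Rightarrow> real) \<Rightarrow> 'a \<Rightarrow> 'a \<Rightarrow> bool" where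
  "adj w x y \<longleftrightarrow> w x y > 0"

definition connected_graph :: "('a \<Rightarrow> 'a \<Rightarrow> real) \<Rightarrow> bool" where
  "connected_graph w \<longleftrightarrow>
     (\<forall>x y. \<exists>n z. z 0 = x \<and> z n = y \<and> (\<forall>i<n. adj w (z i) (z (Suc i))))"

definition infinite_path :: "('a \<Rightarrow> 'a \<Rightarrow> real) \<Rightarrow> (nat \<Rightarrow> 'a) \<Rightarrow> bool" where
  "infinite_path w z \<longleftrightarrow> (\<forall>i. adj w (z i) (z (Suc i))) \<and> inj z"

text \<open>As \<open>\<mu>\<close> is positive, a divergent series of values of \<open>\<mu>\<close> has sum infinity.\<close>

definition cond_IP :: "('a \<Rightarrow> 'a \<Rightarrow> real) \<Rightarrow> ('a \<Rightarrow> real) \<Rightarrow> bool" where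
  "cond_IP w \<mu> \<longleftrightarrow> (\<forall>z. infinite_path w z \<longrightarrow> \<not> summable (\<lambda>n. \<mu> (z n)))"

definition cond_B :: "('a \<Rightarrow> 'a \<Rightarrow> real) \<Rightarrow> ('a \<Rightarrow> real) \<Rightarrow> bool" where
  "cond_B w \<mu> \<longleftrightarrow> bdd_above (range (\<lambda>x. (\<Sum>\<^sub>\<infinity>y. w x y) / \<mu> x))"

section \<open>The nonlinearity\<close>

text \<open>\<open>antimono\<close> is monotone decreasing in the weak sense, so \<open>f = 0\<close> is allowed.\<close>

definition cond_F1 :: "(real \<Rightarrow> real) \<Rightarrow> bool" where
  "cond_F1 f \<longleftrightarrow> continuous_on UNIV f \<and> antimono f \<and> f 0 = 0"

definition cond_F2 :: "real \<Rightarrow> (real \<Rightarrow> real) \<Rightarrow> bool" where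
  "cond_F2 L f \<longleftrightarrow> L > 0 \<and> L-lipschitz_on UNIV f \<and> f 0 = 0"

section \<open>The weighted sequence spaces\<close>

definition lp :: "('a \<Rightarrow> real) \<Rightarrow> real \<Rightarrow> ('a \<Rightarrow> real) set" where
  "lp \<mu> p = {u. (\<lambda>x. \<bar>u x\<bar> powr p * \<mu> x) summable_on UNIV}"

definition lp_norm :: "('a \<Rightarrow> real) \<Rightarrow> real \<Rightarrow> ('a \<Rightarrow> real) \<Rightarrow> real" where
  "lp_norm \<mu> p u = (\<Sum>\<^sub>\<infinity>x. \<bar>u x\<bar> powr p * \<mu> x) powr (1 / p)"

definition lp_pos :: "('a \<Rightarrow> real) \<Rightarrow> real \<Rightarrow> ('a \<Rightarrow> real) set" where
  "lp_pos \<mu> p = {u \<in> lp \<mu> p. \<forall>x. u x \<ge> 0}"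

definition lp_neg :: "('a \<Rightarrow> real) \<Rightarrow> real \<Rightarrow> ('a \<Rightarrow> real) set" where
  "lp_neg \<mu> p = uminus ` lp_pos \<mu> p"

definition lp_dense_in :: "('a \<Rightarrow> real) \<Rightarrow> real \<Rightarrow> ('a \<Rightarrow> real) set \<Rightarrow> ('a \<Rightarrow> real) set \<Rightarrow> bool" where
  "lp_dense_in \<mu> p D S \<longleftrightarrow>
     D \<subseteq> S \<and> (\<forall>u\<in>S. \<forall>e>0. \<exists>v\<in>D. lp_norm \<mu> p (\<lambda>x. u x - v x) < e)"

section \<open>Operators\<close>

definition lap_dom :: "('a \<Rightarrow> 'a \<Rightarrow> real) \<Rightarrow> ('a \<Rightarrow> real) set" where
  "lap_dom w = {u. \<forall>x. (\<lambda>y. w x y * \<bar>u y\<bar>) summable_on UNIV}"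

definition lap ::
  "('a \<Rightarrow> 'a \<Rightarrow> real) \<Rightarrow> ('a \<Rightarrow> real) \<Rightarrow> ('a \<Rightarrow> real) \<Rightarrow> ('a \<Rightarrow> real) \<Rightarrow> 'a \<Rightarrow> real" where
  "lap w \<kappa> \<mu> u x = 1 / \<mu> x * (\<Sum>\<^sub>\<infinity>y. w x y * (u x - u y)) + \<kappa> x / \<mu> x * u x"

definition opA ::
  "('a \<Rightarrow> 'a \<Rightarrow> real) \<Rightarrow> ('a \<Rightarrow> real) \<Rightarrow> ('a \<Rightarrow> real) \<Rightarrow> (real \<Rightarrow> real) \<Rightarrow> ('a \<Rightarrow> real) \<Rightarrow> 'a \<Rightarrow> real" where
  "opA w \<kappa> \<mu> f u x = - f (u x) + lap w \<kappa> \<mu> u x"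

definition opA_dom ::
  "('a \<Rightarrow> 'a \<Rightarrow> real) \<Rightarrow> ('a \<Rightarrow> real) \<Rightarrow> ('a \<Rightarrow> real) \<Rightarrow> (real \<Rightarrow> real) \<Rightarrow> real \<Rightarrow> ('a \<Rightarrow> real) set" where
  "opA_dom w \<kappa> \<mu> f p = {u \<in> lp \<mu> p. u \<in> lap_dom w \<and> opA w \<kappa> \<mu> f u \<in> lp \<mu> p}"

text \<open>Accretivity on \<open>lp \<mu> p\<close> of the operator with domain \<open>D\<close> acting as \<open>B\<close>, that is, of the
  restriction of \<open>B\<close> to \<open>D\<close>.\<close>

definition lp_accretive ::
  "('a \<Rightarrow> real) \<Rightarrow> real \<Rightarrow> ('a \<Rightarrow> real) set \<Rightarrow> (('a \<Rightarrow> real) \<Rightarrow> 'a \<Rightarrow> real) \<Rightarrow> bool" where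
  "lp_accretive \<mu> p D B \<longleftrightarrow>
     D \<subseteq> lp \<mu> p \<and> B ` D \<subseteq> lp \<mu> p \<and>
     (\<forall>u\<in>D. \<forall>v\<in>D. \<forall>t>0.
        lp_norm \<mu> p (\<lambda>x. (u x - v x) + t * (B u x - B v x)) \<ge> lp_norm \<mu> p (\<lambda>x. u x - v x))"

definition lp_omega_accretive ::
  "real \<Rightarrow> ('a \<Rightarrow> real) \<Rightarrow> real \<Rightarrow> ('a \<Rightarrow> real) set \<Rightarrow> (('a \<Rightarrow> real) \<Rightarrow> 'a \<Rightarrow> real) \<Rightarrow> bool" where
  "lp_omega_accretive \<omega> \<mu> p D B \<longleftrightarrow> lp_accretive \<mu> p D (\<lambda>u x. B u x + \<omega> * u x)"

definition solves ::
  "('a \<Rightarrow> 'a \<Rightarrow> real) \<Rightarrow> ('a \<Rightarrow> real) \<Rightarrow> ('a \<Rightarrow> real) \<Rightarrow> (real \<Rightarrow> real) \<Rightarrow> real \<Rightarrow>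
    ('a \<Rightarrow> real) \<Rightarrow> ('a \<Rightarrow> real) \<Rightarrow> bool" where
  "solves w \<kappa> \<mu> f t g u \<longleftrightarrow> u \<in> lap_dom w \<and> (\<forall>x. u x + t * opA w \<kappa> \<mu> f u x = g x)"

text \<open>\<open>u\<close> is the only solution in \<open>D\<close>, and its norm is at most \<open>M\<close>.\<close>

definition unique_solution ::
  "('a \<Rightarrow> 'a \<Rightarrow> real) \<Rightarrow> ('a \<Rightarrow> real) \<Rightarrow> ('a \<Rightarrow> real) \<Rightarrow> (real \<Rightarrow> real) \<Rightarrow> real \<Rightarrow> real \<Rightarrow>
    ('a \<Rightarrow> real) \<Rightarrow> ('a \<Rightarrow> real) set \<Rightarrow> real \<Rightarrow> ('a \<Rightarrow> real) \<Rightarrow> bool" where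
  "unique_solution w \<kappa> \<mu> f p t g D M u \<longleftrightarrow>
     u \<in> D \<and> solves w \<kappa> \<mu> f t g u \<and> lp_norm \<mu> p u \<le> M \<and>
     (\<forall>v\<in>D. solves w \<kappa> \<mu> f t g v \<longrightarrow> v = u)"

end

theory Submission imports Defs begin

text \<open>Both hypotheses on the nonlinearity say that \<open>f b - f a \<le> \<omega> * (b - a)\<close> whenever \<open>a \<le> b\<close>, with
  \<open>\<omega> = 0\<close> in the monotone case and \<open>\<omega> = L\<close> in the Lipschitz case. Everything is proved at once for
  such \<open>f\<close> and for parameters \<open>t > 0\<close> with \<open>t * \<omega> < 1\<close>.

  The nonlinear problem is controlled by one linear operator, \<open>h \<mapsto> (1 - t * \<omega>) h + t \<Delta> h\<close>
  (\<open>comparison_op\<close>). Kato's inequality (\<open>kato_inequality\<close>) says that this operator maps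
  \<open>\<bar>u - v\<bar>\<close> below \<open>\<bar>(u - v) + t (A u - A v)\<bar>\<close>. The operator satisfies a maximum principle on finite
  sets of nodes (\<open>comparison_principle\<close>), and if it maps \<open>h \<ge> 0\<close> below \<open>k\<close> then Young's inequality and
  the symmetry of the weights give \<open>(1 - t * \<omega>) \<parallel>h\<parallel> \<le> \<parallel>k\<parallel>\<close>, provided that \<open>h\<^sup>p\<close> is summable against
  the weighted degree (\<open>lp_norm_le_if_comparison_op_le\<close>). That proviso holds for finitely supported \<open>h\<close>.

  The domain \<open>\<Omega>\<close> (\<open>approx_dom\<close>) consists of the \<open>u\<close> such that both \<open>u\<close> and \<open>A u\<close> are limits, dominated in
  \<open>\<ell>\<^sup>p\<close>, of the corresponding functions for Dirichlet problems on an exhaustion by finite sets. The norm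
  estimate holds for these finite problems and passes to the limit by dominated convergence, which gives
  accretivity, uniqueness and the norm bounds. \<open>\<Omega>\<close> is dense because it contains all
  finitely supported functions; here the summability of \<open>w(x,y)\<^sup>p / \<mu>(y)\<^sup>p\<^sup>-\<^sup>1\<close> enters, since it puts
  the Laplacian of a point mass into \<open>\<ell>\<^sup>p\<close>.

  For the existence of solutions let \<open>V\<^sub>n\<close> be the Dirichlet solution, on the \<open>n\<close>-th finite set,
  of the linear comparison equation with right-hand side \<open>\<bar>g\<bar>\<close>. The \<open>V\<^sub>n\<close> increase and are bounded in
  \<open>\<ell>\<^sup>p\<close>, so they have a limit \<open>V\<close> in \<open>\<ell>\<^sup>p\<close> (\<open>linear_resolvent\<close>). If \<open>U\<^sub>n\<close> are the
  Dirichlet solutions of the nonlinear equation, then Kato's inequality and the maximum principle give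
  both \<open>\<bar>U\<^sub>n\<bar> \<le> V\<close> and \<open>\<bar>U\<^sub>m - U\<^sub>n\<bar> \<le> V - V\<^sub>n\<close> for \<open>n \<le> m\<close>. The second bound makes
  \<open>U\<^sub>n\<close> a Cauchy sequence at every node, the first allows one to pass to the limit in the infinite sum of
  the Laplacian (\<open>resolvent_equation_solvable\<close>). This works for data \<open>g\<close> of any sign.

  Finally \<open>\<Omega>\<close> is the whole of \<open>dom\<^sub>p(A)\<close> as soon as \<open>id + t A\<close> is injective there: a given \<open>u\<close> then
  agrees with the solution in \<open>\<Omega>\<close> that has the same right-hand side. For two functions with the same
  image, \<open>h = \<bar>u - v\<bar>\<close> satisfies \<open>(1 - t * \<omega>) h + t \<Delta> h \<le> 0\<close>. Under (B) the norm estimate applies to \<open>h\<close>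
  itself. Under (IP), a node with \<open>h > 0\<close> has a neighbour where \<open>h\<close> is larger, so \<open>h\<close> increases
  along an infinite path, on which \<open>\<mu>\<close> then has a finite sum (\<open>resolvent_injective\<close>).\<close>

section \<open>Sums over a countable set\<close>

lemma summable_dominated:
  fixes a :: "'b \<Rightarrow> real"
  assumes "b summable_on A" "\<And>x. x \<in> A \<Longrightarrow> \<bar>a x\<bar> \<le> b x"
  shows "a summable_on A"
proof (rule abs_summable_summable)
  show "(\<lambda>x. norm (a x)) summable_on A"
    by (rule summable_on_comparison_test[OF assms(1)]) (use assms(2) in auto)
qed

lemma infsum_diff:
  fixes a b :: "'b \<Rightarrow> real"
  assumes "a summable_on A" "b summable_on A"
  shows "(\<Sum>\<^sub>\<infinity>x\<in>A. a x - b x) = infsum a A - infsum b A"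
  using infsum_add[of a A "\<lambda>x. - b x"] assms by (simp add: summable_on_uminus infsum_uminus)

text \<open>The sum is an integral against counting measure, so the dominated convergence theorem for
  the Bochner integral applies.\<close>

lemma infsum_dominated_convergence:
  fixes a :: "nat \<Rightarrow> 'b \<Rightarrow> real"
  assumes b: "b summable_on A"
    and bound: "\<And>n x. x \<in> A \<Longrightarrow> \<bar>a n x\<bar> \<le> b x"
    and lim: "\<And>x. x \<in> A \<Longrightarrow> (\<lambda>n. a n x) \<longlonglongrightarrow> l x"
  shows "(\<lambda>n. \<Sum>\<^sub>\<infinity>x\<in>A. a n x) \<longlonglongrightarrow> (\<Sum>\<^sub>\<infinity>x\<in>A. l x)"
proof -
  have lb: "\<bar>l x\<bar> \<le> b x" if "x \<in> A" for x
    using LIMSEQ_le_const2[OF tendsto_rabs[OF lim[OF that]]] bound[OF that] by blast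
  have abs: "Infinite_Set_Sum.abs_summable_on c A" if "\<And>x. x \<in> A \<Longrightarrow> \<bar>c x\<bar> \<le> b x" for c :: "'b \<Rightarrow> real"
  proof -
    have "c summable_on A"
      by (rule summable_dominated[OF b that])
    then show ?thesis
      using abs_summable_equivalent[of c A] summable_on_iff_abs_summable_on_real[of c A] by blast
  qed
  have bb: "Infinite_Set_Sum.abs_summable_on b A"
    using b abs_summable_equivalent[of b A] summable_on_iff_abs_summable_on_real[of b A] by blast
  have eq: "infsum c A = integral\<^sup>L (count_space A) c" if "\<And>x. x \<in> A \<Longrightarrow> \<bar>c x\<bar> \<le> b x" for c
    using infsetsum_infsum[OF abs[OF that]] by (simp add: infsetsum_def)
  have "(\<lambda>n. integral\<^sup>L (count_space A) (a n)) \<longlonglongrightarrow> integral\<^sup>L (count_space A) l"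
    by (rule integral_dominated_convergence[where w=b])
       (use bb bound lim in \<open>auto simp: Infinite_Set_Sum.abs_summable_on_def AE_count_space\<close>)
  then show ?thesis
    using eq[of l] eq[of "a _"] lb bound by simp
qed

text \<open>The graph of the convex function \<open>a \<mapsto> a powr p\<close> lies above its tangent at \<open>b\<close>. Being linear in
  \<open>a\<close>, this form of Young's inequality can be summed over neighbours against the edge weights.\<close>

lemma powr_tangent_inequality:
  fixes a b p :: real
  assumes p: "1 \<le> p" and a: "0 \<le> a" and b: "0 < b"
  shows "p * b powr (p - 1) * a \<le> a powr p + (p - 1) * b powr p"
proof (cases "a = 0 \<or> p = 1")
  case True
  with assms show ?thesis by auto
next
  case False
  then have a: "0 < a" and p: "1 < p" using assms by auto
  have "(a powr p) powr (1 / p) * (b powr p) powr (1 - 1 / p)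
      \<le> 1 / p * a powr p + (1 - 1 / p) * b powr p"
    by (rule Youngs_inequality_0) (use p a b in auto)
  moreover have "(a powr p) powr (1 / p) = a"
    using a p by (simp add: powr_powr)
  moreover have "(b powr p) powr (1 - 1 / p) = b powr (p - 1)"
    using p by (simp add: powr_powr right_diff_distrib)
  ultimately have "a * b powr (p - 1) \<le> 1 / p * a powr p + (1 - 1 / p) * b powr p"
    by simp
  then have "p * (a * b powr (p - 1)) \<le> p * (1 / p * a powr p + (1 - 1 / p) * b powr p)"
    using p by (intro mult_left_mono) auto
  then show ?thesis
    using p by (simp add: distrib_left right_diff_distrib left_diff_distrib mult_ac)
qed

lemma powr_add_le:
  fixes a b p :: real
  assumes "0 \<le> p" "0 \<le> a" "0 \<le> b"
  shows "(a + b) powr p \<le> 2 powr p * (a powr p + b powr p)"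
proof -
  have "(a + b) powr p \<le> (2 * max a b) powr p"
    using assms by (intro powr_mono2) auto
  also have "\<dots> = 2 powr p * max a b powr p"
    using assms by (simp add: powr_mult)
  also have "\<dots> \<le> 2 powr p * (a powr p + b powr p)"
    by (intro mult_left_mono) (auto simp: max_def)
  finally show ?thesis .
qed

section \<open>Exhaustion by finite sets\<close>

definition stage :: "nat \<Rightarrow> 'a::countable set" where
  "stage n = {x. to_nat x < n}"

lemma finite_stage: "finite (stage n :: 'a::countable set)"
  by (rule inj_on_finite[of to_nat _ "{..<n}"]) (auto simp: stage_def intro: inj_on_subset[OF inj_to_nat])

lemma stage_mono: "m \<le> n \<Longrightarrow> stage m \<subseteq> stage n"
  by (auto simp: stage_def)

lemma eventually_in_stage: "eventually (\<lambda>n. x \<in> stage n) sequentially"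
  unfolding stage_def using eventually_gt_at_top[of "to_nat x"] by simp

section \<open>Weighted sequence spaces\<close>

locale lp_graph = weighted_graph +
  fixes p :: real
  assumes p_ge_1: "1 \<le> p"
begin

lemma lp_dominated:
  assumes v: "v \<in> lp \<mu> p" and le: "\<And>x. \<bar>u x\<bar> \<le> \<bar>v x\<bar>"
  shows "u \<in> lp \<mu> p"
  unfolding lp_def mem_Collect_eq
proof (rule summable_on_comparison_test)
  show "(\<lambda>x. \<bar>v x\<bar> powr p * \<mu> x) summable_on UNIV"
    using v by (simp add: lp_def)
  show "\<bar>u x\<bar> powr p * \<mu> x \<le> \<bar>v x\<bar> powr p * \<mu> x" for x
    using le[of x] \<mu>_pos[of x] p_ge_1 by (intro mult_right_mono powr_mono2) auto
  show "0 \<le> \<bar>u x\<bar> powr p * \<mu> x" for x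
    using \<mu>_pos[of x] by simp
qed

lemma lp_abs: "u \<in> lp \<mu> p \<Longrightarrow> (\<lambda>x. \<bar>u x\<bar>) \<in> lp \<mu> p"
  by (rule lp_dominated) auto

lemma lp_scale: "u \<in> lp \<mu> p \<Longrightarrow> (\<lambda>x. a * u x) \<in> lp \<mu> p"
  using summable_on_cmult_right[of "\<lambda>x. \<bar>u x\<bar> powr p * \<mu> x" UNIV "\<bar>a\<bar> powr p"]
  by (simp add: lp_def abs_mult powr_mult mult.assoc)

lemma lp_add:
  assumes u: "u \<in> lp \<mu> p" and v: "v \<in> lp \<mu> p"
  shows "(\<lambda>x. u x + v x) \<in> lp \<mu> p"
  unfolding lp_def mem_Collect_eq
proof (rule summable_on_comparison_test)
  show "(\<lambda>x. 2 powr p * (\<bar>u x\<bar> powr p * \<mu> x + \<bar>v x\<bar> powr p * \<mu> x)) summable_on UNIV"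
    using u v by (intro summable_on_cmult_right summable_on_add) (auto simp: lp_def)
  fix x
  have "\<bar>u x + v x\<bar> powr p \<le> (\<bar>u x\<bar> + \<bar>v x\<bar>) powr p"
    using p_ge_1 by (intro powr_mono2) auto
  also have "\<dots> \<le> 2 powr p * (\<bar>u x\<bar> powr p + \<bar>v x\<bar> powr p)"
    using p_ge_1 by (intro powr_add_le) auto
  finally show "\<bar>u x + v x\<bar> powr p * \<mu> x
      \<le> 2 powr p * (\<bar>u x\<bar> powr p * \<mu> x + \<bar>v x\<bar> powr p * \<mu> x)"
    using \<mu>_pos[of x] mult_right_mono[of _ _ "\<mu> x"] by (fastforce simp: algebra_simps)
  show "0 \<le> \<bar>u x + v x\<bar> powr p * \<mu> x"
    using \<mu>_pos[of x] by simp
qed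

lemma lp_diff: "u \<in> lp \<mu> p \<Longrightarrow> v \<in> lp \<mu> p \<Longrightarrow> (\<lambda>x. u x - v x) \<in> lp \<mu> p"
  using lp_add[of u "\<lambda>x. -1 * v x"] lp_scale[of v "-1"] by simp

lemma lp_finite_support:
  assumes "finite K" "\<And>x. x \<notin> K \<Longrightarrow> u x = 0"
  shows "u \<in> lp \<mu> p"
proof -
  have "(\<lambda>x. \<bar>u x\<bar> powr p * \<mu> x) summable_on UNIV \<longleftrightarrow> (\<lambda>x. \<bar>u x\<bar> powr p * \<mu> x) summable_on K"
    by (rule summable_on_cong_neutral) (use assms in auto)
  then show ?thesis using assms by (simp add: lp_def)
qed

lemma lp_sum: "finite F \<Longrightarrow> (\<And>i. i \<in> F \<Longrightarrow> u i \<in> lp \<mu> p) \<Longrightarrow> (\<lambda>x. \<Sum>i\<in>F. u i x) \<in> lp \<mu> p"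
  by (induction F rule: finite_induct) (auto intro: lp_add lp_finite_support[of "{}"])

lemma lp_term_nonneg: "0 \<le> \<bar>u x\<bar> powr p * \<mu> x"
  using \<mu>_pos[of x] by simp

lemma lp_power_sum_nonneg: "0 \<le> (\<Sum>\<^sub>\<infinity>x. \<bar>u x\<bar> powr p * \<mu> x)"
  by (rule infsum_nonneg) (rule lp_term_nonneg)

lemma lp_norm_nonneg: "0 \<le> lp_norm \<mu> p u"
  by (simp add: lp_norm_def)

lemma lp_norm_powr: "lp_norm \<mu> p u powr p = (\<Sum>\<^sub>\<infinity>x. \<bar>u x\<bar> powr p * \<mu> x)"
  using p_ge_1 lp_power_sum_nonneg[of u] by (simp add: lp_norm_def powr_powr)

lemma lp_norm_zero: "lp_norm \<mu> p (\<lambda>x. 0) = 0"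
  using p_ge_1 by (simp add: lp_norm_def)

lemma lp_norm_scale: "lp_norm \<mu> p (\<lambda>x. a * u x) = \<bar>a\<bar> * lp_norm \<mu> p u"
proof -
  have "(\<Sum>\<^sub>\<infinity>x. \<bar>a * u x\<bar> powr p * \<mu> x) = \<bar>a\<bar> powr p * (\<Sum>\<^sub>\<infinity>x. \<bar>u x\<bar> powr p * \<mu> x)"
    by (simp add: abs_mult powr_mult mult.assoc infsum_cmult_right')
  then show ?thesis
    using p_ge_1 lp_power_sum_nonneg[of u] by (simp add: lp_norm_def powr_mult powr_powr)
qed

lemma lp_norm_mono:
  assumes v: "v \<in> lp \<mu> p" and le: "\<And>x. \<bar>u x\<bar> \<le> \<bar>v x\<bar>"
  shows "lp_norm \<mu> p u \<le> lp_norm \<mu> p v"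
proof -
  have "(\<Sum>\<^sub>\<infinity>x. \<bar>u x\<bar> powr p * \<mu> x) \<le> (\<Sum>\<^sub>\<infinity>x. \<bar>v x\<bar> powr p * \<mu> x)"
    using lp_dominated[OF v le] v le \<mu>_pos p_ge_1
    by (intro infsum_mono mult_right_mono powr_mono2) (auto simp: lp_def less_imp_le)
  then show ?thesis
    unfolding lp_norm_def using p_ge_1 lp_power_sum_nonneg[of u] by (intro powr_mono2) auto
qed

lemma lp_coordinate_bound:
  assumes u: "u \<in> lp \<mu> p"
  shows "\<bar>u x\<bar> powr p * \<mu> x \<le> lp_norm \<mu> p u powr p"
proof -
  have "(\<Sum>y\<in>{x}. \<bar>u y\<bar> powr p * \<mu> y) \<le> (\<Sum>\<^sub>\<infinity>y. \<bar>u y\<bar> powr p * \<mu> y)"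
    by (rule finite_sum_le_infsum) (use u lp_term_nonneg in \<open>auto simp: lp_def\<close>)
  then show ?thesis by (simp add: lp_norm_powr)
qed

lemma lp_norm_eq_0:
  assumes u: "u \<in> lp \<mu> p" and "lp_norm \<mu> p u \<le> 0"
  shows "u x = 0"
proof -
  have "\<bar>u x\<bar> powr p * \<mu> x \<le> 0"
    using lp_coordinate_bound[OF u, of x] assms(2) lp_norm_nonneg[of u] by simp
  then show ?thesis
    using \<mu>_pos[of x] by (auto simp: mult_le_0_iff)
qed

text \<open>Dominated pointwise convergence is stable under linear combinations, so this passes to the limit
  on both sides of an estimate between norms; hence approximating sequences below come with a dominating function.\<close>

lemma lp_norm_tendsto:
  assumes V: "V \<in> lp \<mu> p" and bound: "\<And>n x. \<bar>U n x\<bar> \<le> V x"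
    and lim: "\<And>x. (\<lambda>n. U n x) \<longlonglongrightarrow> u x"
  shows "(\<lambda>n. lp_norm \<mu> p (U n)) \<longlonglongrightarrow> lp_norm \<mu> p u"
proof -
  have "(\<lambda>n. \<Sum>\<^sub>\<infinity>x. \<bar>U n x\<bar> powr p * \<mu> x) \<longlonglongrightarrow> (\<Sum>\<^sub>\<infinity>x. \<bar>u x\<bar> powr p * \<mu> x)"
  proof (rule infsum_dominated_convergence)
    show "(\<lambda>x. \<bar>V x\<bar> powr p * \<mu> x) summable_on UNIV"
      using V by (simp add: lp_def)
    show "\<bar>\<bar>U n x\<bar> powr p * \<mu> x\<bar> \<le> \<bar>V x\<bar> powr p * \<mu> x" for n x
      using bound[of n x] \<mu>_pos[of x] p_ge_1
      by (auto simp: abs_mult intro!: mult_right_mono powr_mono2)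
    show "(\<lambda>n. \<bar>U n x\<bar> powr p * \<mu> x) \<longlonglongrightarrow> \<bar>u x\<bar> powr p * \<mu> x" for x
      using p_ge_1 by (intro tendsto_mult tendsto_powr' tendsto_rabs lim tendsto_const) auto
  qed
  then show ?thesis
    unfolding lp_norm_def using p_ge_1
    by (intro tendsto_powr' tendsto_const) (auto intro!: always_eventually lp_power_sum_nonneg)
qed

text \<open>Fatou's lemma: a pointwise limit of a bounded sequence stays in the space, because every
  finite partial sum of the limit obeys the common bound.\<close>

lemma lp_fatou:
  assumes U: "\<And>n. U n \<in> lp \<mu> p" and B: "\<And>n. lp_norm \<mu> p (U n) \<le> B"
    and lim: "\<And>x. (\<lambda>n. U n x) \<longlonglongrightarrow> u x"
  shows "u \<in> lp \<mu> p"
  unfolding lp_def mem_Collect_eq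
proof (rule nonneg_bdd_above_summable_on)
  show "0 \<le> \<bar>u x\<bar> powr p * \<mu> x" for x
    using \<mu>_pos[of x] by simp
  have "(\<Sum>x\<in>F. \<bar>u x\<bar> powr p * \<mu> x) \<le> B powr p" if F: "finite F" for F
  proof (rule LIMSEQ_le_const2)
    show "(\<lambda>n. \<Sum>x\<in>F. \<bar>U n x\<bar> powr p * \<mu> x) \<longlonglongrightarrow> (\<Sum>x\<in>F. \<bar>u x\<bar> powr p * \<mu> x)"
      using p_ge_1 by (intro tendsto_sum tendsto_mult tendsto_powr' tendsto_rabs lim tendsto_const) auto
    have "(\<Sum>x\<in>F. \<bar>U n x\<bar> powr p * \<mu> x) \<le> B powr p" for n
    proof -
      have "(\<Sum>x\<in>F. \<bar>U n x\<bar> powr p * \<mu> x) \<le> (\<Sum>\<^sub>\<infinity>x. \<bar>U n x\<bar> powr p * \<mu> x)"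
        by (rule finite_sum_le_infsum) (use F U lp_term_nonneg in \<open>auto simp: lp_def\<close>)
      also have "\<dots> \<le> B powr p"
        unfolding lp_norm_powr[symmetric] using B[of n] lp_norm_nonneg[of "U n"] p_ge_1
        by (intro powr_mono2) auto
      finally show ?thesis .
    qed
    then show "\<exists>N. \<forall>n\<ge>N. (\<Sum>x\<in>F. \<bar>U n x\<bar> powr p * \<mu> x) \<le> B powr p" by blast
  qed
  then show "bdd_above (sum (\<lambda>x. \<bar>u x\<bar> powr p * \<mu> x) ` {F. F \<subseteq> UNIV \<and> finite F})"
    by (intro bdd_aboveI2) auto
qed

end

section \<open>The Laplacian and the comparison operator\<close>

definition wdeg :: "('a \<Rightarrow> 'a \<Rightarrow> real) \<Rightarrow> 'a \<Rightarrow> real" where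
  "wdeg w x = (\<Sum>\<^sub>\<infinity>y. w x y)"

text \<open>The common content of (F1) and (F2): \<open>f\<close> satisfies a one-sided Lipschitz condition with
  constant \<open>\<omega>\<close>, so that \<open>f - \<omega> id\<close> is decreasing.\<close>

definition reaction :: "real \<Rightarrow> (real \<Rightarrow> real) \<Rightarrow> bool" where
  "reaction \<omega> f \<longleftrightarrow> 0 \<le> \<omega> \<and> continuous_on UNIV f \<and> f 0 = 0 \<and>
     (\<forall>a b. a \<le> b \<longrightarrow> f b - f a \<le> \<omega> * (b - a))"

lemma reaction_0_if_F1: "cond_F1 f \<Longrightarrow> reaction 0 f"
  by (auto simp: cond_F1_def reaction_def antimono_def)

lemma reaction_if_F2:
  assumes "cond_F2 L f"
  shows "reaction L f"
proof -
  have L: "0 < L" "f 0 = 0" and lip: "L-lipschitz_on UNIV f"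
    using assms by (auto simp: cond_F2_def)
  have "f b - f a \<le> L * (b - a)" if "a \<le> b" for a b
    using lipschitz_onD[OF lip, of b a] that by (auto simp: dist_real_def)
  then show ?thesis
    using L lipschitz_on_continuous_on[OF lip] by (auto simp: reaction_def)
qed

text \<open>The extreme case of the one-sided condition; it makes the linear comparison problems below
  instances of the nonlinear ones.\<close>

lemma reaction_linear: "0 \<le> \<omega> \<Longrightarrow> reaction \<omega> (\<lambda>s. \<omega> * s)"
  by (auto simp: reaction_def algebra_simps intro!: continuous_intros)

text \<open>With all neighbouring values given, the equation at one node has this form. Its left-hand side has slope
  at least \<open>1 - t * \<omega> > 0\<close>, so the intermediate value theorem on \<open>[-\<bar>r\<bar> / (1 - t * \<omega>), \<bar>r\<bar> / (1 - t * \<omega>)]\<close>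
  gives a solution.\<close>

lemma node_equation_solvable:
  assumes f: "reaction \<omega> f" and t: "0 < t" "t * \<omega> < 1" and a: "0 \<le> a"
  shows "\<exists>s. (1 + a) * s - t * f s = (r::real)"
proof -
  define c where "c = 1 - t * \<omega>"
  have c: "0 < c" using t by (simp add: c_def)
  define \<phi> where "\<phi> s = (1 + a) * s - t * f s" for s
  have growth: "c * (s' - s) \<le> \<phi> s' - \<phi> s" if "s \<le> s'" for s s'
  proof -
    have "t * (f s' - f s) \<le> t * (\<omega> * (s' - s))"
      using f that t by (intro mult_left_mono) (auto simp: reaction_def)
    moreover have "0 \<le> a * (s' - s)" using a that by simp
    ultimately show ?thesis by (simp add: \<phi>_def c_def algebra_simps)
  qed
  have \<phi>0: "\<phi> 0 = 0" using f by (simp add: \<phi>_def reaction_def)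
  have "\<exists>s\<ge>- (\<bar>r\<bar> / c). s \<le> \<bar>r\<bar> / c \<and> \<phi> s = r"
  proof (rule IVT')
    show "\<phi> (- (\<bar>r\<bar> / c)) \<le> r"
      using growth[of "- (\<bar>r\<bar> / c)" 0] c \<phi>0 by simp
    show "r \<le> \<phi> (\<bar>r\<bar> / c)"
      using growth[of 0 "\<bar>r\<bar> / c"] c \<phi>0 by simp
    show "- (\<bar>r\<bar> / c) \<le> \<bar>r\<bar> / c" using c by simp
    show "continuous_on {- (\<bar>r\<bar> / c)..\<bar>r\<bar> / c} \<phi>"
      unfolding \<phi>_def using f
      by (intro continuous_intros) (auto simp: reaction_def intro: continuous_on_subset)
  qed
  then show ?thesis by (auto simp: \<phi>_def)
qed

context weighted_graph
begin

lemma wdeg_nonneg: "0 \<le> wdeg w x"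
  unfolding wdeg_def by (rule infsum_nonneg) (simp add: w_nonneg)

lemma lap_dom_summable: "u \<in> lap_dom w \<Longrightarrow> (\<lambda>y. w x y * u y) summable_on UNIV"
  by (rule summable_dominated[where b="\<lambda>y. w x y * \<bar>u y\<bar>"])
     (auto simp: lap_dom_def abs_mult w_nonneg)

lemma lap_dom_dominated:
  assumes "v \<in> lap_dom w" "\<And>x. \<bar>u x\<bar> \<le> \<bar>v x\<bar>"
  shows "u \<in> lap_dom w"
  unfolding lap_dom_def mem_Collect_eq
proof
  show "(\<lambda>y. w x y * \<bar>u y\<bar>) summable_on UNIV" for x
    by (rule summable_dominated[where b="\<lambda>y. w x y * \<bar>v y\<bar>"])
       (use assms in \<open>auto simp: lap_dom_def abs_mult w_nonneg intro!: mult_left_mono\<close>)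
qed

lemma lap_dom_diff:
  assumes "u \<in> lap_dom w" "v \<in> lap_dom w"
  shows "(\<lambda>x. u x - v x) \<in> lap_dom w"
  unfolding lap_dom_def mem_Collect_eq
proof
  show "(\<lambda>y. w x y * \<bar>u y - v y\<bar>) summable_on UNIV" for x
  proof (rule summable_dominated[where b="\<lambda>y. w x y * \<bar>u y\<bar> + w x y * \<bar>v y\<bar>"])
    show "(\<lambda>y. w x y * \<bar>u y\<bar> + w x y * \<bar>v y\<bar>) summable_on UNIV"
      using assms by (intro summable_on_add) (auto simp: lap_dom_def)
    show "\<bar>w x y * \<bar>u y - v y\<bar>\<bar> \<le> w x y * \<bar>u y\<bar> + w x y * \<bar>v y\<bar>" for y
      using mult_left_mono[OF abs_triangle_ineq4[of "u y" "v y"] w_nonneg[of x y]] w_nonneg[of x y]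
      by (simp add: abs_mult distrib_left)
  qed
qed

lemma lap_dom_abs: "u \<in> lap_dom w \<Longrightarrow> (\<lambda>x. \<bar>u x\<bar>) \<in> lap_dom w"
  by (rule lap_dom_dominated) auto

lemma lap_dom_finite_support:
  assumes "finite K" "\<And>x. x \<notin> K \<Longrightarrow> u x = 0"
  shows "u \<in> lap_dom w"
  unfolding lap_dom_def mem_Collect_eq
proof
  fix x
  have "(\<lambda>y. w x y * \<bar>u y\<bar>) summable_on UNIV \<longleftrightarrow> (\<lambda>y. w x y * \<bar>u y\<bar>) summable_on K"
    by (rule summable_on_cong_neutral) (use assms in auto)
  then show "(\<lambda>y. w x y * \<bar>u y\<bar>) summable_on UNIV" using assms by simp
qed

lemma lap_altdef:
  assumes "u \<in> lap_dom w"
  shows "lap w \<kappa> \<mu> u x = ((wdeg w x + \<kappa> x) * u x - (\<Sum>\<^sub>\<infinity>y. w x y * u y)) / \<mu> x"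
proof -
  have "(\<Sum>\<^sub>\<infinity>y. w x y * (u x - u y)) = (\<Sum>\<^sub>\<infinity>y. w x y * u x - w x y * u y)"
    by (rule infsum_cong) (simp add: algebra_simps)
  also have "\<dots> = (\<Sum>\<^sub>\<infinity>y. w x y * u x) - (\<Sum>\<^sub>\<infinity>y. w x y * u y)"
    using w_summable[of x] lap_dom_summable[OF assms, of x]
    by (intro infsum_diff summable_on_cmult_left)
  also have "\<dots> = wdeg w x * u x - (\<Sum>\<^sub>\<infinity>y. w x y * u y)"
    by (simp add: infsum_cmult_left' wdeg_def)
  finally show ?thesis
    unfolding lap_def using \<mu>_pos[of x] by (simp add: field_simps)
qed

lemma resolvent_eq:
  assumes "u \<in> lap_dom w"
  shows "u x + t * opA w \<kappa> \<mu> f u x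
    = (1 + t * (wdeg w x + \<kappa> x) / \<mu> x) * u x - t * f (u x) - t / \<mu> x * (\<Sum>\<^sub>\<infinity>y. w x y * u y)"
  unfolding opA_def lap_altdef[OF assms] using \<mu>_pos[of x] by (simp add: field_simps)

lemma opA_tendsto:
  assumes V: "V \<in> lap_dom w" and bound: "\<And>n x. \<bar>U n x\<bar> \<le> V x"
    and lim: "\<And>x. (\<lambda>n. U n x) \<longlonglongrightarrow> u x" and f: "continuous_on UNIV f"
  shows "(\<lambda>n. opA w \<kappa> \<mu> f (U n) x) \<longlonglongrightarrow> opA w \<kappa> \<mu> f u x"
proof -
  have le: "\<bar>u x\<bar> \<le> V x" for x
    using LIMSEQ_le_const2[OF tendsto_rabs[OF lim[of x]]] bound by blast
  have dom: "U n \<in> lap_dom w" "u \<in> lap_dom w" for n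
    by (rule lap_dom_dominated[OF V]; use bound le in \<open>fastforce intro: order_trans[OF _ abs_ge_self]\<close>)+
  have "(\<lambda>n. \<Sum>\<^sub>\<infinity>y. w x y * U n y) \<longlonglongrightarrow> (\<Sum>\<^sub>\<infinity>y. w x y * u y)"
    by (rule infsum_dominated_convergence[where b="\<lambda>y. w x y * V y"])
       (use bound in \<open>auto simp: abs_mult w_nonneg lap_dom_summable[OF V]
          intro!: mult_left_mono tendsto_mult lim tendsto_const\<close>)
  moreover have "(\<lambda>n. f (U n x)) \<longlonglongrightarrow> f (u x)"
    using f lim[of x] by (auto intro: continuous_on_tendsto_compose)
  moreover have "\<mu> x \<noteq> 0" using \<mu>_pos[of x] by simp
  ultimately show ?thesis
    unfolding opA_def lap_altdef[OF dom(1)] lap_altdef[OF dom(2)]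
    by (intro tendsto_add tendsto_minus tendsto_divide tendsto_diff tendsto_mult tendsto_const lim)
qed

text \<open>The resolvent equation for the linear reaction \<open>s \<mapsto> \<omega> * s\<close>, that is, the operator
  \<open>(1 - t * \<omega>) id + t \<Delta>\<close>. Keeping it in resolvent form lets the results on general reactions apply to
  it.\<close>

definition comparison_op :: "real \<Rightarrow> real \<Rightarrow> ('a \<Rightarrow> real) \<Rightarrow> 'a \<Rightarrow> real" where
  "comparison_op \<omega> t h x = h x + t * opA w \<kappa> \<mu> (\<lambda>s. \<omega> * s) h x"

lemma comparison_op_eq:
  assumes "h \<in> lap_dom w"
  shows "comparison_op \<omega> t h x
    = (1 - t * \<omega> + t * (wdeg w x + \<kappa> x) / \<mu> x) * h x - t / \<mu> x * (\<Sum>\<^sub>\<infinity>y. w x y * h y)"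
  unfolding comparison_op_def resolvent_eq[OF assms] by (simp add: algebra_simps)

lemma comparison_op_diff:
  assumes "u \<in> lap_dom w" "v \<in> lap_dom w"
  shows "comparison_op \<omega> t (\<lambda>x. u x - v x) x = comparison_op \<omega> t u x - comparison_op \<omega> t v x"
proof -
  have "(\<Sum>\<^sub>\<infinity>y. w x y * (u y - v y)) = (\<Sum>\<^sub>\<infinity>y. w x y * u y - w x y * v y)"
    by (rule infsum_cong) (simp add: algebra_simps)
  also have "\<dots> = (\<Sum>\<^sub>\<infinity>y. w x y * u y) - (\<Sum>\<^sub>\<infinity>y. w x y * v y)"
    using assms by (intro infsum_diff lap_dom_summable)
  finally show ?thesis
    unfolding comparison_op_eq[OF assms(1)] comparison_op_eq[OF assms(2)] comparison_op_eq[OF lap_dom_diff[OF assms]]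
    by (simp only: right_diff_distrib)
qed

text \<open>Where \<open>v x \<le> u x\<close>, replacing \<open>u - v\<close> by its absolute value only increases the neighbouring values,
  hence decreases the Laplacian, while the reaction terms differ by at most \<open>\<omega> * (u x - v x)\<close>. The other case
  follows by exchanging \<open>u\<close> and \<open>v\<close>.\<close>

lemma kato_inequality:
  assumes f: "reaction \<omega> f" and t: "0 < t" and u: "u \<in> lap_dom w" and v: "v \<in> lap_dom w"
  shows "comparison_op \<omega> t (\<lambda>y. \<bar>u y - v y\<bar>) x
    \<le> \<bar>(u x - v x) + t * (opA w \<kappa> \<mu> f u x - opA w \<kappa> \<mu> f v x)\<bar>"
proof -
  have main: "comparison_op \<omega> t (\<lambda>y. \<bar>u y - v y\<bar>) x
      \<le> (u x - v x) + t * (opA w \<kappa> \<mu> f u x - opA w \<kappa> \<mu> f v x)"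
    if le: "v x \<le> u x" and u: "u \<in> lap_dom w" and v: "v \<in> lap_dom w" for u v
  proof -
    note d = lap_dom_diff[OF u v]
    have "(\<Sum>\<^sub>\<infinity>y. w x y * (u y - v y)) \<le> (\<Sum>\<^sub>\<infinity>y. w x y * \<bar>u y - v y\<bar>)"
      by (rule infsum_mono) (auto intro: mult_left_mono w_nonneg lap_dom_summable d lap_dom_abs[OF d])
    then have "t / \<mu> x * (\<Sum>\<^sub>\<infinity>y. w x y * (u y - v y)) \<le> t / \<mu> x * (\<Sum>\<^sub>\<infinity>y. w x y * \<bar>u y - v y\<bar>)"
      using t \<mu>_pos[of x] by (intro mult_left_mono) auto
    then have "comparison_op \<omega> t (\<lambda>y. \<bar>u y - v y\<bar>) x \<le> comparison_op \<omega> t (\<lambda>y. u y - v y) x"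
      using le by (simp add: comparison_op_eq[OF d] comparison_op_eq[OF lap_dom_abs[OF d]])
    also have "\<dots> = comparison_op \<omega> t u x - comparison_op \<omega> t v x"
      by (rule comparison_op_diff[OF u v])
    also have "\<dots> = (u x - v x) + t * (opA w \<kappa> \<mu> f u x - opA w \<kappa> \<mu> f v x)
        + t * ((f (u x) - f (v x)) - \<omega> * (u x - v x))"
      by (simp add: comparison_op_def opA_def algebra_simps)
    also have "\<dots> \<le> (u x - v x) + t * (opA w \<kappa> \<mu> f u x - opA w \<kappa> \<mu> f v x)"
    proof -
      have "(f (u x) - f (v x)) - \<omega> * (u x - v x) \<le> 0"
        using f le by (simp add: reaction_def)
      then show ?thesis using t by (simp add: mult_le_0_iff)
    qed
    finally show ?thesis .
  qed
  show ?thesis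
  proof (cases "v x \<le> u x")
    case True
    show ?thesis using main[OF True u v] by linarith
  next
    case False
    then have "u x \<le> v x" by simp
    from main[OF this v u]
    have "comparison_op \<omega> t (\<lambda>y. \<bar>u y - v y\<bar>) x
      \<le> - ((u x - v x) + t * (opA w \<kappa> \<mu> f u x - opA w \<kappa> \<mu> f v x))"
      by (simp add: abs_minus_commute algebra_simps)
    then show ?thesis by linarith
  qed
qed

text \<open>Maximum principle. A positive maximum of \<open>u - v\<close> would be attained in the finite set
  \<open>K\<close>. There the Laplacian of \<open>u - v\<close> is nonnegative and the reaction terms contribute at most \<open>t * \<omega> < 1\<close>
  times the maximum, so the left-hand side of the inequality on \<open>K\<close> would be the larger one.\<close>

lemma comparison_principle:
  assumes K: "finite K" and f: "reaction \<omega> f" and t: "0 < t" "t * \<omega> < 1"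
    and u: "u \<in> lap_dom w" and v: "v \<in> lap_dom w"
    and inside: "\<And>x. x \<in> K \<Longrightarrow> u x + t * opA w \<kappa> \<mu> f u x \<le> v x + t * opA w \<kappa> \<mu> f v x"
    and outside: "\<And>x. x \<notin> K \<Longrightarrow> u x \<le> v x"
  shows "u x \<le> v x"
proof (rule ccontr)
  assume x: "\<not> u x \<le> v x"
  define d where "d = (\<lambda>y. u y - v y)"
  have ne: "K \<noteq> {}" using outside[of x] x by auto
  obtain z where z: "z \<in> K" "\<And>y. y \<in> K \<Longrightarrow> d y \<le> d z"
    using Max_in[of "d ` K"] Max_ge[of "d ` K"] K ne
    by (metis (no_types, lifting) finite_imageI image_eqI imageE image_is_empty)
  have dz: "0 < d z" using outside[of x] x z(2)[of x] by (force simp: d_def)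
  have dmax: "d y \<le> d z" for y
    using z(2)[of y] outside[of y] dz by (force simp: d_def)
  note ddom = lap_dom_diff[OF u v, folded d_def]
  have "(\<Sum>\<^sub>\<infinity>y. w z y * d y) \<le> (\<Sum>\<^sub>\<infinity>y. w z y * d z)"
    using w_summable dmax
    by (intro infsum_mono lap_dom_summable[OF ddom] summable_on_cmult_left mult_left_mono w_nonneg) auto
  also have "\<dots> = wdeg w z * d z"
    by (simp add: infsum_cmult_left' wdeg_def)
  finally have sum: "(\<Sum>\<^sub>\<infinity>y. w z y * d y) \<le> wdeg w z * d z" .
  have "(1 - t * \<omega>) * d z \<le> comparison_op \<omega> t d z"
  proof -
    have "t / \<mu> z * (\<Sum>\<^sub>\<infinity>y. w z y * d y) \<le> t / \<mu> z * (wdeg w z * d z)"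
      using sum t \<mu>_pos[of z] by (intro mult_left_mono) auto
    moreover have "0 \<le> t / \<mu> z * (\<kappa> z * d z)"
      using t \<mu>_pos[of z] \<kappa>_nonneg[of z] dz by simp
    moreover have "(1 - t * \<omega> + t * (wdeg w z + \<kappa> z) / \<mu> z) * d z
      = (1 - t * \<omega>) * d z + t / \<mu> z * (wdeg w z * d z) + t / \<mu> z * (\<kappa> z * d z)"
      using \<mu>_pos[of z] by (simp add: field_simps)
    ultimately show ?thesis
      unfolding comparison_op_eq[OF ddom] by linarith
  qed
  also have "\<dots> = comparison_op \<omega> t u z - comparison_op \<omega> t v z"
    unfolding d_def by (rule comparison_op_diff[OF u v])
  also have "\<dots> = (u z + t * opA w \<kappa> \<mu> f u z) - (v z + t * opA w \<kappa> \<mu> f v z)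
      + t * ((f (u z) - f (v z)) - \<omega> * d z)"
    by (simp add: comparison_op_def opA_def d_def algebra_simps)
  also have "\<dots> \<le> 0"
  proof -
    have "(f (u z) - f (v z)) - \<omega> * d z \<le> 0"
      using f dz by (simp add: reaction_def d_def)
    then have "t * ((f (u z) - f (v z)) - \<omega> * d z) \<le> 0"
      using t by (simp add: mult_le_0_iff)
    then show ?thesis using inside[OF z(1)] by linarith
  qed
  finally show False
    using t(2) dz by (simp add: mult_le_0_iff)
qed

lemma opA_zero: "f 0 = 0 \<Longrightarrow> opA w \<kappa> \<mu> f (\<lambda>x. 0) x = 0"
  by (simp add: opA_def lap_def)

lemma comparison_op_zero: "comparison_op \<omega> t (\<lambda>x. 0) x = 0"
  by (simp add: comparison_op_def opA_zero)

lemma zero_in_lap_dom: "(\<lambda>x. 0) \<in> lap_dom w"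
  by (simp add: lap_dom_def)

lemma comparison_op_monotone:
  assumes K: "finite K" and t: "0 < t" "t * \<omega> < 1" and \<omega>: "0 \<le> \<omega>"
    and "u \<in> lap_dom w" "v \<in> lap_dom w"
    and "\<And>x. x \<in> K \<Longrightarrow> comparison_op \<omega> t u x \<le> comparison_op \<omega> t v x"
    and "\<And>x. x \<notin> K \<Longrightarrow> u x \<le> v x"
  shows "u x \<le> v x"
  using assms comparison_principle[OF K reaction_linear[OF \<omega>] t, of u v x]
  by (simp add: comparison_op_def)

section \<open>Dirichlet problems\<close>

text \<open>Solving the equation node by node gives an iteration that preserves order. A large negative
  constant is a subsolution and the opposite constant a supersolution, so the iteration started at the former increases
  and stays bounded; its limit solves the problem because only finitely many nodes are involved.\<close>

lemma dirichlet_problem_solvable: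
  assumes K: "finite K" and f: "reaction \<omega> f" and t: "0 < t" "t * \<omega> < 1"
  shows "\<exists>u. (\<forall>x. x \<notin> K \<longrightarrow> u x = 0) \<and> (\<forall>x\<in>K. u x + t * opA w \<kappa> \<mu> f u x = g x)"
proof -
  define c where "c = 1 - t * \<omega>"
  have c: "0 < c" using t by (simp add: c_def)
  define a where "a x = t * (wdeg w x + \<kappa> x) / \<mu> x" for x
  have a: "0 \<le> a x" "t / \<mu> x * wdeg w x \<le> a x" for x
    using t \<mu>_pos[of x] \<kappa>_nonneg[of x] wdeg_nonneg[of x] by (auto simp: a_def field_simps)
  define \<phi> where "\<phi> x s = (1 + a x) * s - t * f s" for x s
  have growth: "(c + a x) * (s' - s) \<le> \<phi> x s' - \<phi> x s" if "s \<le> s'" for x s s'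
  proof -
    have "t * (f s' - f s) \<le> t * (\<omega> * (s' - s))"
      using f that t by (intro mult_left_mono) (auto simp: reaction_def)
    then show ?thesis by (simp add: \<phi>_def c_def algebra_simps)
  qed
  \<comment> \<open>the equation at a node preserves order, hence so does solving it\<close>
  have mono_inv: "s \<le> s'" if "\<phi> x s \<le> \<phi> x s'" for x s s'
  proof (rule ccontr)
    assume "\<not> s \<le> s'"
    moreover have "0 < c + a x" using c a(1)[of x] by simp
    ultimately have "0 < (c + a x) * (s - s')" by simp
    then show False using growth[of s' s x] \<open>\<not> s \<le> s'\<close> that by simp
  qed
  have "\<forall>x r. \<exists>s. \<phi> x s = r"
    unfolding \<phi>_def using node_equation_solvable[OF f t a(1)] by blast
  then obtain \<psi> where \<psi>: "\<phi> x (\<psi> x r) = r" for x r by metis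
  define N where "N u x = t / \<mu> x * (\<Sum>y\<in>K. w x y * u y)" for u x
  have N_mono: "N u x \<le> N v x" if "\<And>y. y \<in> K \<Longrightarrow> u y \<le> v y" for u v x
    unfolding N_def using that t \<mu>_pos[of x]
    by (intro mult_left_mono sum_mono) (auto intro: mult_left_mono w_nonneg)
  have \<phi>0: "\<phi> x 0 = 0" for x using f by (simp add: \<phi>_def reaction_def)
  \<comment> \<open>large enough for the constants \<open>-M\<close> and \<open>M\<close> to be a sub- and a supersolution\<close>
  define M where "M = (\<Sum>x\<in>K. \<bar>g x\<bar>) / c"
  have M: "0 \<le> M" using c by (simp add: M_def sum_nonneg)
  have gM: "\<bar>g x\<bar> \<le> c * M" if "x \<in> K" for x
    using member_le_sum[OF that, of "\<lambda>x. \<bar>g x\<bar>"] K c by (simp add: M_def)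
  have N_const: "N (\<lambda>_. M) x \<le> a x * M" for x
  proof -
    have "(\<Sum>y\<in>K. w x y) \<le> wdeg w x"
      unfolding wdeg_def by (rule finite_sum_le_infsum) (use K w_summable w_nonneg in auto)
    then have "t / \<mu> x * ((\<Sum>y\<in>K. w x y) * M) \<le> t / \<mu> x * (wdeg w x * M)"
      using M t \<mu>_pos[of x] by (intro mult_left_mono mult_right_mono) auto
    also have "\<dots> \<le> a x * M"
      using mult_right_mono[OF a(2)[of x] M] by (simp add: mult.assoc)
    finally show ?thesis by (simp add: N_def sum_distrib_right)
  qed
  define U where "U = rec_nat (\<lambda>_. - M) (\<lambda>_ u x. \<psi> x (g x + N u x))"
  have U0: "U 0 x = - M" and US: "\<phi> x (U (Suc n) x) = g x + N (U n) x" for n x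
    by (simp_all add: U_def \<psi>)
  have upper: "U n x \<le> M" if "x \<in> K" for n x
    using that
  proof (induction n arbitrary: x)
    case 0
    show ?case using U0 M by simp
  next
    case (Suc n)
    have "\<phi> x (U (Suc n) x) \<le> g x + N (\<lambda>_. M) x"
      unfolding US using N_mono[of "U n" "\<lambda>_. M"] Suc.IH by simp
    also have "\<dots> \<le> (c + a x) * (M - 0)"
      using gM[OF Suc.prems] N_const[of x] by (simp add: algebra_simps)
    also have "\<dots> \<le> \<phi> x M"
      using growth[OF M, of x] \<phi>0[of x] by simp
    finally show ?case by (rule mono_inv)
  qed
  have incr: "U n x \<le> U (Suc n) x" if "x \<in> K" for n x
    using that
  proof (induction n arbitrary: x)
    case 0
    have "(c + a x) * M \<le> - \<phi> x (- M)"
      using growth[of "- M" 0 x] \<phi>0[of x] M by simp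
    moreover have "N (U 0) x = - N (\<lambda>_. M) x"
      by (simp add: N_def U0 sum_negf)
    ultimately have "\<phi> x (U 0 x) \<le> g x + N (U 0) x"
      using gM[OF 0] N_const[of x] by (simp add: algebra_simps U0 abs_le_iff)
    then show ?case unfolding US[symmetric] by (rule mono_inv)
  next
    case (Suc n)
    have "\<phi> x (U (Suc n) x) \<le> \<phi> x (U (Suc (Suc n)) x)"
      unfolding US using N_mono[of "U n" "U (Suc n)"] Suc.IH by simp
    then show ?case by (rule mono_inv)
  qed
  have "\<exists>l. (\<lambda>n. U n x) \<longlonglongrightarrow> l" if "x \<in> K" for x
    using incseq_convergent[of "\<lambda>n. U n x" M] upper[OF that] incr[OF that]
    by (metis incseq_SucI)
  then obtain l where l: "x \<in> K \<Longrightarrow> (\<lambda>n. U n x) \<longlonglongrightarrow> l x" for x by metis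
  define u where "u x = (if x \<in> K then l x else 0)" for x
  have udom: "u \<in> lap_dom w"
    by (rule lap_dom_finite_support[OF K]) (simp add: u_def)
  have "u x + t * opA w \<kappa> \<mu> f u x = g x" if x: "x \<in> K" for x
  proof -
    have lim: "(\<lambda>n. U n y) \<longlonglongrightarrow> u y" if "y \<in> K" for y
      using l[OF that] that by (simp add: u_def)
    have fl: "(\<lambda>n. f (U (Suc n) x)) \<longlonglongrightarrow> f (u x)"
      using f LIMSEQ_Suc[OF lim[OF x]] by (auto simp: reaction_def intro: continuous_on_tendsto_compose)
    have "(\<lambda>n. \<phi> x (U (Suc n) x)) \<longlonglongrightarrow> \<phi> x (u x)"
      unfolding \<phi>_def by (intro tendsto_diff tendsto_mult tendsto_const fl LIMSEQ_Suc[OF lim[OF x]])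
    moreover have "(\<lambda>n. \<phi> x (U (Suc n) x)) \<longlonglongrightarrow> g x + N u x"
      unfolding US N_def by (intro tendsto_add tendsto_mult tendsto_const tendsto_sum lim)
    ultimately have eq: "\<phi> x (u x) = g x + N u x"
      by (rule LIMSEQ_unique)
    have "(\<Sum>\<^sub>\<infinity>y. w x y * u y) = (\<Sum>\<^sub>\<infinity>y\<in>K. w x y * u y)"
      by (rule infsum_cong_neutral) (auto simp: u_def)
    then show ?thesis
      using eq K unfolding resolvent_eq[OF udom] by (simp add: \<phi>_def a_def N_def)
  qed
  then show ?thesis by (intro exI[of _ u]) (auto simp: u_def)
qed

end

context lp_graph
begin

section \<open>The norm estimate\<close>

text \<open>The \<open>\<ell>\<^sup>p\<close> estimate. At every node the hypothesis bounds \<open>h x\<close> by a convex combination of \<open>k x / c\<close>,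
  where \<open>c = 1 - t * \<omega>\<close>, and of the values at the neighbours, so by convexity \<open>(h x)\<^sup>p\<close> is bounded by
  the same combination of \<open>p\<close>-th powers. Summed over \<open>x\<close> against \<open>\<mu>\<close>, the neighbour terms give, by symmetry of the
  weights, \<open>t\<close> times the sum of the weighted degree times \<open>h\<^sup>p\<close>. The diagonal terms contain the same quantity, and it cancels
  because it is finite.\<close>

lemma lp_norm_le_if_comparison_op_le:
  assumes t: "0 < t" "t * \<omega> < 1"
    and h: "h \<in> lp \<mu> p" "h \<in> lap_dom w" "\<And>x. 0 \<le> h x"
    and deg_h: "(\<lambda>x. wdeg w x * h x powr p) summable_on UNIV"
    and k: "k \<in> lp \<mu> p" "\<And>x. 0 \<le> k x"
    and le: "\<And>x. comparison_op \<omega> t h x \<le> k x"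
  shows "(1 - t * \<omega>) * lp_norm \<mu> p h \<le> lp_norm \<mu> p k"
proof -
  define c where "c = 1 - t * \<omega>"
  have c: "0 < c" using t by (simp add: c_def)
  define H where "H x = h x powr p" for x
  define R where "R x = (k x / c) powr p" for x
  have H0: "0 \<le> H x" and R0: "0 \<le> R x" for x by (simp_all add: H_def R_def)
  have col: "((\<lambda>x. w x y * H y) has_sum wdeg w y * H y) UNIV" for y
    using has_sum_cmult_left[OF has_sum_infsum[OF w_summable[of y]], of "H y"]
    by (simp add: wdeg_def w_sym[of _ y])
  have "(\<lambda>(y, x). w x y * H y) summable_on UNIV \<times> UNIV"
    by (rule summable_on_SigmaI[where g="\<lambda>y. wdeg w y * H y"])
       (use col deg_h in \<open>auto simp: H_def w_nonneg\<close>)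
  then have double: "(\<lambda>(x, y). w x y * H y) summable_on UNIV \<times> UNIV"
    using summable_on_swap[of "\<lambda>(y, x). w x y * H y" UNIV UNIV] by simp
  have row: "(\<lambda>y. w x y * H y) summable_on UNIV" for x
    using summable_on_SigmaD1[OF double, of x] w_nonneg H0 by simp
  have rows: "(\<lambda>x. \<Sum>\<^sub>\<infinity>y. w x y * H y) summable_on UNIV"
    using summable_on_Sigma_banach[OF double] by simp
  have swap: "(\<Sum>\<^sub>\<infinity>x. \<Sum>\<^sub>\<infinity>y. w x y * H y) = (\<Sum>\<^sub>\<infinity>y. wdeg w y * H y)"
    unfolding infsum_swap_banach[OF double] by (simp add: infsumI[OF col])
  have Hsum: "(\<lambda>x. H x * \<mu> x) summable_on UNIV"
    using h by (simp add: lp_def H_def)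
  have Rsum: "(\<lambda>x. R x * \<mu> x) summable_on UNIV"
    using lp_scale[OF k(1), of "1 / c"] k(2) c by (simp add: lp_def R_def)
  \<comment> \<open>the convexity estimate at one node, multiplied by \<open>\<mu> x\<close>\<close>
  have pointwise: "c * (H x * \<mu> x) + t * (wdeg w x * H x)
      \<le> c * (R x * \<mu> x) + t * (\<Sum>\<^sub>\<infinity>y. w x y * H y)" for x
  proof (cases "h x = 0")
    case True
    moreover have "0 \<le> (\<Sum>\<^sub>\<infinity>y. w x y * H y)"
      by (rule infsum_nonneg) (simp add: w_nonneg H0)
    ultimately show ?thesis
      using c t \<mu>_pos[of x] R0[of x] by (simp add: H_def)
  next
    case False
    then have b: "0 < h x" using h(3)[of x] by simp
    define q where "q = p * h x powr (p - 1)"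
    have q: "0 < q" using b p_ge_1 by (simp add: q_def)
    have qb: "q * h x = p * H x"
      using b powr_add[of "h x" "p - 1" 1] by (simp add: q_def H_def)
    have young: "q * a \<le> a powr p + (p - 1) * H x" if "0 \<le> a" for a
      unfolding q_def H_def by (rule powr_tangent_inequality[OF p_ge_1 that b])
    define S where "S = (\<Sum>\<^sub>\<infinity>y. w x y * h y)"
    have "c * \<mu> x * h x + t * (wdeg w x * h x) \<le> \<mu> x * k x + t * S"
    proof -
      have "c * \<mu> x * h x + t * (wdeg w x * h x) + t * (\<kappa> x * h x) - t * S
          = \<mu> x * comparison_op \<omega> t h x"
        unfolding comparison_op_eq[OF h(2)] S_def[symmetric] c_def using \<mu>_pos[of x]
        by (simp add: field_simps)
      also have "\<dots> \<le> \<mu> x * k x"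
        using le[of x] \<mu>_pos[of x] by (intro mult_left_mono) auto
      finally have "c * \<mu> x * h x + t * (wdeg w x * h x) + t * (\<kappa> x * h x) - t * S \<le> \<mu> x * k x" .
      moreover have "0 \<le> t * (\<kappa> x * h x)"
        using t \<kappa>_nonneg[of x] b by simp
      ultimately show ?thesis by linarith
    qed
    then have "q * (c * \<mu> x * h x + t * (wdeg w x * h x)) \<le> q * (\<mu> x * k x + t * S)"
      using q by (intro mult_left_mono) auto
    moreover have "q * (c * \<mu> x * h x + t * (wdeg w x * h x))
        = (q * h x) * (c * \<mu> x + t * wdeg w x)"
      by (simp add: algebra_simps)
    then have "q * (c * \<mu> x * h x + t * (wdeg w x * h x))
        = p * (c * (H x * \<mu> x) + t * (wdeg w x * H x))"
      unfolding qb by (simp add: algebra_simps)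
    moreover have "q * (\<mu> x * k x) \<le> c * (R x * \<mu> x) + (p - 1) * (c * (H x * \<mu> x))"
    proof -
      have "c * \<mu> x * (q * (k x / c)) \<le> c * \<mu> x * (R x + (p - 1) * H x)"
        using young[of "k x / c"] k(2)[of x] c \<mu>_pos[of x]
        by (intro mult_left_mono) (auto simp: R_def)
      then show ?thesis using c by (simp add: algebra_simps)
    qed
    moreover have "q * S \<le> (\<Sum>\<^sub>\<infinity>y. w x y * H y) + (p - 1) * (wdeg w x * H x)"
    proof -
      have "q * S = (\<Sum>\<^sub>\<infinity>y. w x y * (q * h y))"
        by (simp add: S_def mult.left_commute flip: infsum_cmult_right')
      also have "\<dots> \<le> (\<Sum>\<^sub>\<infinity>y. w x y * H y + w x y * ((p - 1) * H x))"
      proof (rule infsum_mono)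
        show "(\<lambda>y. w x y * (q * h y)) summable_on UNIV"
          using summable_on_cmult_right[OF lap_dom_summable[OF h(2)], of q x]
          by (simp add: mult.left_commute)
        show "(\<lambda>y. w x y * H y + w x y * ((p - 1) * H x)) summable_on UNIV"
          by (intro summable_on_add row summable_on_cmult_left w_summable)
        show "w x y * (q * h y) \<le> w x y * H y + w x y * ((p - 1) * H x)" for y
          using mult_left_mono[OF young[OF h(3)[of y]] w_nonneg[of x y]]
          by (simp add: H_def distrib_left)
      qed
      also have "\<dots> = (\<Sum>\<^sub>\<infinity>y. w x y * H y) + (\<Sum>\<^sub>\<infinity>y. w x y * ((p - 1) * H x))"
        by (intro infsum_add row summable_on_cmult_left w_summable)
      finally show ?thesis
        unfolding infsum_cmult_left' wdeg_def by (simp only: mult.left_commute)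
    qed
    then have "t * (q * S) \<le> t * (\<Sum>\<^sub>\<infinity>y. w x y * H y) + (p - 1) * (t * (wdeg w x * H x))"
      using t mult_left_mono[of _ _ t] by (fastforce simp: algebra_simps)
    ultimately show ?thesis by (simp add: algebra_simps)
  qed
  have "(\<Sum>\<^sub>\<infinity>x. c * (H x * \<mu> x) + t * (wdeg w x * H x))
      \<le> (\<Sum>\<^sub>\<infinity>x. c * (R x * \<mu> x) + t * (\<Sum>\<^sub>\<infinity>y. w x y * H y))"
    using deg_h by (intro infsum_mono summable_on_add summable_on_cmult_right Hsum Rsum rows pointwise)
      (auto simp: H_def)
  also have "(\<Sum>\<^sub>\<infinity>x. c * (H x * \<mu> x) + t * (wdeg w x * H x))
      = c * (\<Sum>\<^sub>\<infinity>x. H x * \<mu> x) + t * (\<Sum>\<^sub>\<infinity>x. wdeg w x * H x)"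
    using deg_h by (subst infsum_add)
      (auto simp: infsum_cmult_right' H_def[symmetric] intro!: summable_on_cmult_right Hsum)
  also have "(\<Sum>\<^sub>\<infinity>x. c * (R x * \<mu> x) + t * (\<Sum>\<^sub>\<infinity>y. w x y * H y))
      = c * (\<Sum>\<^sub>\<infinity>x. R x * \<mu> x) + t * (\<Sum>\<^sub>\<infinity>x. wdeg w x * H x)"
    by (subst infsum_add)
      (auto simp: infsum_cmult_right' swap intro!: summable_on_cmult_right Rsum rows)
  finally have "(\<Sum>\<^sub>\<infinity>x. H x * \<mu> x) \<le> (\<Sum>\<^sub>\<infinity>x. R x * \<mu> x)"
    using c by simp
  then have "lp_norm \<mu> p h \<le> lp_norm \<mu> p (\<lambda>x. 1 / c * k x)"
    unfolding lp_norm_def using p_ge_1 h(3) k(2) c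
    by (intro powr_mono2) (auto simp: H_def R_def intro!: infsum_nonneg mult_nonneg_nonneg less_imp_le[OF \<mu>_pos])
  then show ?thesis
    using c unfolding lp_norm_scale c_def[symmetric] by (simp add: field_simps)
qed

text \<open>Only the values of the operator inside \<open>K\<close> matter: at the other nodes \<open>\<bar>u - v\<bar>\<close> vanishes, so
  its image under the comparison operator is nonpositive.\<close>

lemma dirichlet_estimate:
  assumes K: "finite K" and f: "reaction \<omega> f" and t: "0 < t" "t * \<omega> < 1"
    and u: "\<And>x. x \<notin> K \<Longrightarrow> u x = 0" and v: "\<And>x. x \<notin> K \<Longrightarrow> v x = 0"
  shows "(1 - t * \<omega>) * lp_norm \<mu> p (\<lambda>x. u x - v x) \<le> lp_norm \<mu> p
    (\<lambda>x. if x \<in> K then (u x - v x) + t * (opA w \<kappa> \<mu> f u x - opA w \<kappa> \<mu> f v x) else 0)"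
    (is "_ \<le> lp_norm \<mu> p ?k")
proof -
  define h where "h x = \<bar>u x - v x\<bar>" for x
  have h0: "h x = 0" if "x \<notin> K" for x using u v that by (simp add: h_def)
  have dom: "u \<in> lap_dom w" "v \<in> lap_dom w" "h \<in> lap_dom w"
    by (rule lap_dom_finite_support[OF K]; use u v h0 in simp)+
  have "(1 - t * \<omega>) * lp_norm \<mu> p h \<le> lp_norm \<mu> p (\<lambda>x. \<bar>?k x\<bar>)"
  proof (rule lp_norm_le_if_comparison_op_le[OF t])
    show "h \<in> lp \<mu> p" "(\<lambda>x. \<bar>?k x\<bar>) \<in> lp \<mu> p"
      by (rule lp_finite_support[OF K]; use h0 in simp)+
    show "0 \<le> h x" "0 \<le> \<bar>?k x\<bar>" for x by (simp_all add: h_def)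
    have "(\<lambda>x. wdeg w x * h x powr p) summable_on UNIV \<longleftrightarrow> (\<lambda>x. wdeg w x * h x powr p) summable_on K"
      by (rule summable_on_cong_neutral) (auto simp: h0)
    then show "(\<lambda>x. wdeg w x * h x powr p) summable_on UNIV"
      using K by simp
    show "comparison_op \<omega> t h x \<le> \<bar>?k x\<bar>" for x
    proof (cases "x \<in> K")
      case True
      then show ?thesis
        using kato_inequality[OF f t(1) dom(1,2), of x] by (simp add: h_def[abs_def])
    next
      case False
      have "0 \<le> (\<Sum>\<^sub>\<infinity>y. w x y * h y)"
        by (rule infsum_nonneg) (simp add: w_nonneg h_def)
      then show ?thesis
        using False t(1) \<mu>_pos[of x] by (simp add: comparison_op_eq[OF dom(3)] h0)
    qed
  qed (fact dom(3))
  then show ?thesis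
    unfolding lp_norm_def h_def by simp
qed

section \<open>The approximable domain and accretivity\<close>

text \<open>This is the set \<open>\<Omega>\<close>. Every \<open>U n\<close> lives on the same finite set \<open>stage n\<close> for all members, so that two
  approximating sequences can be compared term by term. The operator is dominated inside \<open>stage n\<close> only; outside,
  \<open>opA (U n)\<close> need not be controlled in \<open>\<ell>\<^sup>p\<close>.\<close>

definition approx_dom :: "(real \<Rightarrow> real) \<Rightarrow> ('a \<Rightarrow> real) set" where
  "approx_dom f = {u \<in> opA_dom w \<kappa> \<mu> f p. \<exists>U V. V \<in> lp \<mu> p \<and>
     (\<forall>n x. x \<notin> stage n \<longrightarrow> U n x = 0) \<and> (\<forall>n x. \<bar>U n x\<bar> \<le> V x) \<and>
     (\<forall>n. \<forall>x\<in>stage n. \<bar>opA w \<kappa> \<mu> f (U n) x\<bar> \<le> V x) \<and>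
     (\<forall>x. (\<lambda>n. U n x) \<longlonglongrightarrow> u x) \<and>
     (\<forall>x. (\<lambda>n. opA w \<kappa> \<mu> f (U n) x) \<longlonglongrightarrow> opA w \<kappa> \<mu> f u x)}"

lemma approx_dom_subset: "approx_dom f \<subseteq> opA_dom w \<kappa> \<mu> f p"
  by (auto simp: approx_dom_def)

lemma opA_dom_lp:
  assumes "u \<in> opA_dom w \<kappa> \<mu> f p"
  shows "u \<in> lp \<mu> p" "opA w \<kappa> \<mu> f u \<in> lp \<mu> p" "u \<in> lap_dom w"
  using assms by (auto simp: opA_dom_def)

lemma accretive_estimate:
  assumes f: "reaction \<omega> f" and t: "0 < t" "t * \<omega> < 1"
    and u: "u \<in> approx_dom f" and v: "v \<in> approx_dom f"
  shows "(1 - t * \<omega>) * lp_norm \<mu> p (\<lambda>x. u x - v x)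
    \<le> lp_norm \<mu> p (\<lambda>x. (u x - v x) + t * (opA w \<kappa> \<mu> f u x - opA w \<kappa> \<mu> f v x))"
proof -
  obtain U B where U: "B \<in> lp \<mu> p" "\<And>n x. x \<notin> stage n \<Longrightarrow> U n x = 0" "\<And>n x. \<bar>U n x\<bar> \<le> B x"
      "\<And>n x. x \<in> stage n \<Longrightarrow> \<bar>opA w \<kappa> \<mu> f (U n) x\<bar> \<le> B x" "\<And>x. (\<lambda>n. U n x) \<longlonglongrightarrow> u x"
      "\<And>x. (\<lambda>n. opA w \<kappa> \<mu> f (U n) x) \<longlonglongrightarrow> opA w \<kappa> \<mu> f u x"
    using u unfolding approx_dom_def by blast
  obtain V C where V: "C \<in> lp \<mu> p" "\<And>n x. x \<notin> stage n \<Longrightarrow> V n x = 0" "\<And>n x. \<bar>V n x\<bar> \<le> C x"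
      "\<And>n x. x \<in> stage n \<Longrightarrow> \<bar>opA w \<kappa> \<mu> f (V n) x\<bar> \<le> C x" "\<And>x. (\<lambda>n. V n x) \<longlonglongrightarrow> v x"
      "\<And>x. (\<lambda>n. opA w \<kappa> \<mu> f (V n) x) \<longlonglongrightarrow> opA w \<kappa> \<mu> f v x"
    using v unfolding approx_dom_def by blast
  let ?k = "\<lambda>n x. if x \<in> stage n
    then (U n x - V n x) + t * (opA w \<kappa> \<mu> f (U n) x - opA w \<kappa> \<mu> f (V n) x) else 0"
  have BC: "(\<lambda>x. B x + C x) \<in> lp \<mu> p" by (rule lp_add[OF U(1) V(1)])
  have diff: "\<bar>U n x - V n x\<bar> \<le> B x + C x" for n x
    using U(3)[of n x] V(3)[of n x] by linarith
  have "(\<lambda>n. lp_norm \<mu> p (\<lambda>x. U n x - V n x)) \<longlonglongrightarrow> lp_norm \<mu> p (\<lambda>x. u x - v x)"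
    by (rule lp_norm_tendsto[OF BC diff]) (intro tendsto_diff U V)
  then have lhs: "(\<lambda>n. (1 - t * \<omega>) * lp_norm \<mu> p (\<lambda>x. U n x - V n x))
      \<longlonglongrightarrow> (1 - t * \<omega>) * lp_norm \<mu> p (\<lambda>x. u x - v x)"
    by (intro tendsto_mult tendsto_const)
  have rhs: "(\<lambda>n. lp_norm \<mu> p (?k n))
      \<longlonglongrightarrow> lp_norm \<mu> p (\<lambda>x. (u x - v x) + t * (opA w \<kappa> \<mu> f u x - opA w \<kappa> \<mu> f v x))"
  proof (rule lp_norm_tendsto)
    show "(\<lambda>x. (B x + C x) + t * (B x + C x)) \<in> lp \<mu> p"
      by (intro lp_add lp_scale BC U V)
    have pos: "0 \<le> B x" "0 \<le> C x" for x
      using U(3)[of 0 x] V(3)[of 0 x] by (auto intro: order_trans[OF abs_ge_zero])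
    show "\<bar>?k n x\<bar> \<le> (B x + C x) + t * (B x + C x)" for n x
    proof (cases "x \<in> stage n")
      case True
      have "\<bar>t * (opA w \<kappa> \<mu> f (U n) x - opA w \<kappa> \<mu> f (V n) x)\<bar> \<le> t * (B x + C x)"
        using U(4)[OF True] V(4)[OF True] t by (auto simp: abs_mult intro!: mult_left_mono)
      then show ?thesis using True diff[of n x] by auto
    next
      case False
      then show ?thesis using pos[of x] t by simp
    qed
    fix x
    have "(\<lambda>n. (U n x - V n x) + t * (opA w \<kappa> \<mu> f (U n) x - opA w \<kappa> \<mu> f (V n) x))
        \<longlonglongrightarrow> (u x - v x) + t * (opA w \<kappa> \<mu> f u x - opA w \<kappa> \<mu> f v x)"
      by (intro tendsto_add tendsto_diff tendsto_mult tendsto_const U V)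
    then show "(\<lambda>n. ?k n x) \<longlonglongrightarrow> (u x - v x) + t * (opA w \<kappa> \<mu> f u x - opA w \<kappa> \<mu> f v x)"
      by (rule Lim_transform_eventually) (use eventually_in_stage[of x] in eventually_elim, simp)
  qed
  have "(1 - t * \<omega>) * lp_norm \<mu> p (\<lambda>x. U n x - V n x) \<le> lp_norm \<mu> p (?k n)" for n
    by (rule dirichlet_estimate[OF finite_stage f t]) (use U(2) V(2) in auto)
  then show ?thesis
    by (intro LIMSEQ_le[OF lhs rhs]) auto
qed

text \<open>Adding \<open>\<omega> id\<close> to the operator amounts to a change of the parameter: with \<open>s = t / (1 + t * \<omega>)\<close>,
  \<open>id + t (A + \<omega> id) = (1 + t * \<omega>) (id + s A)\<close>, and \<open>1 - s * \<omega> = 1 / (1 + t * \<omega>)\<close> is the constant in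
  the estimate for \<open>s\<close>.\<close>

lemma omega_accretive:
  assumes f: "reaction \<omega> f"
  shows "lp_omega_accretive \<omega> \<mu> p (approx_dom f) (opA w \<kappa> \<mu> f)"
  unfolding lp_omega_accretive_def lp_accretive_def
proof (intro conjI ballI allI impI)
  show "approx_dom f \<subseteq> lp \<mu> p"
    using approx_dom_subset opA_dom_lp by blast
  show "(\<lambda>u x. opA w \<kappa> \<mu> f u x + \<omega> * u x) ` approx_dom f \<subseteq> lp \<mu> p"
    using approx_dom_subset opA_dom_lp by (fast intro: lp_add lp_scale)
  fix u v t assume u: "u \<in> approx_dom f" and v: "v \<in> approx_dom f" and t: "0 < (t::real)"
  have \<omega>: "0 \<le> \<omega>" using f by (simp add: reaction_def)
  define s where "s = t / (1 + t * \<omega>)"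
  have q: "0 < 1 + t * \<omega>" using t \<omega> by (simp add: add_pos_nonneg)
  have s: "0 < s" "s * \<omega> < 1" "1 - s * \<omega> = 1 / (1 + t * \<omega>)"
    using t q by (simp_all add: s_def field_simps)
  have "lp_norm \<mu> p (\<lambda>x. u x - v x)
      \<le> (1 + t * \<omega>) * lp_norm \<mu> p (\<lambda>x. (u x - v x) + s * (opA w \<kappa> \<mu> f u x - opA w \<kappa> \<mu> f v x))"
    using accretive_estimate[OF f s(1,2) u v] q unfolding s(3) by (simp add: field_simps)
  also have "\<dots> = lp_norm \<mu> p (\<lambda>x. (1 + t * \<omega>) *
      ((u x - v x) + s * (opA w \<kappa> \<mu> f u x - opA w \<kappa> \<mu> f v x)))"
    using q by (simp only: lp_norm_scale abs_of_pos)
  also have "(\<lambda>x. (1 + t * \<omega>) * ((u x - v x) + s * (opA w \<kappa> \<mu> f u x - opA w \<kappa> \<mu> f v x)))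
      = (\<lambda>x. u x - v x + t * (opA w \<kappa> \<mu> f u x + \<omega> * u x - (opA w \<kappa> \<mu> f v x + \<omega> * v x)))"
  proof
    fix x
    have ts: "(1 + t * \<omega>) * s = t" using q by (simp add: s_def)
    have "(1 + t * \<omega>) * (d + s * e) = (1 + t * \<omega>) * d + t * e" for d e
      by (simp only: distrib_left mult.assoc[symmetric] ts)
    then show "(1 + t * \<omega>) * ((u x - v x) + s * (opA w \<kappa> \<mu> f u x - opA w \<kappa> \<mu> f v x))
      = u x - v x + t * (opA w \<kappa> \<mu> f u x + \<omega> * u x - (opA w \<kappa> \<mu> f v x + \<omega> * v x))"
      by (simp only:) (simp add: algebra_simps)
  qed
  finally show "lp_norm \<mu> p (\<lambda>x. u x - v x)
      \<le> lp_norm \<mu> p (\<lambda>x. u x - v x + t * (opA w \<kappa> \<mu> f u x + \<omega> * u x - (opA w \<kappa> \<mu> f v x + \<omega> * v x)))" .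
qed

section \<open>Density of the approximable domain\<close>

text \<open>Up to sign, away from \<open>y\<close> this function is the Laplacian of the indicator of \<open>y\<close>. For \<open>p = 1\<close> its norm is the
  weighted degree of \<open>y\<close>.\<close>

lemma edge_weights_in_lp:
  assumes wp: "p > 1 \<Longrightarrow> \<forall>x. (\<lambda>y. w x y powr p / \<mu> y powr (p - 1)) summable_on UNIV"
  shows "(\<lambda>x. w x y / \<mu> x) \<in> lp \<mu> p"
proof -
  have "\<bar>w x y / \<mu> x\<bar> powr p * \<mu> x = w y x powr p / \<mu> x powr (p - 1)" for x
    using \<mu>_pos[of x] w_nonneg[of x y]
    by (simp add: w_sym[of y] powr_divide powr_diff)
  moreover have "(\<lambda>x. w y x powr p / \<mu> x powr (p - 1)) summable_on UNIV"
  proof (cases "p > 1")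
    case False
    then have "w y x powr p / \<mu> x powr (p - 1) = w y x" for x
      using p_ge_1 \<mu>_pos[of x] w_nonneg[of y x] by simp
    then show ?thesis using w_summable[of y] by simp
  qed (use wp in blast)
  ultimately show ?thesis by (simp add: lp_def)
qed

lemma finite_support_in_opA_dom:
  assumes edge: "\<And>y. (\<lambda>x. w x y / \<mu> x) \<in> lp \<mu> p"
    and f: "f 0 = 0" and K: "finite K" "\<And>x. x \<notin> K \<Longrightarrow> u x = 0"
  shows "u \<in> opA_dom w \<kappa> \<mu> f p"
proof -
  have dom: "u \<in> lap_dom w" by (rule lap_dom_finite_support[OF K])
  have "(\<Sum>\<^sub>\<infinity>y. w x y * u y) = (\<Sum>\<^sub>\<infinity>y\<in>K. w x y * u y)" for x
    by (rule infsum_cong_neutral) (auto simp: K)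
  then have eq: "opA w \<kappa> \<mu> f u x
      = (- f (u x) + (wdeg w x + \<kappa> x) * u x / \<mu> x) - (\<Sum>y\<in>K. u y * (w x y / \<mu> x))" for x
    using K(1) by (simp add: opA_def lap_altdef[OF dom] diff_divide_distrib sum_divide_distrib mult.commute)
  have "opA w \<kappa> \<mu> f u \<in> lp \<mu> p"
    unfolding eq
    by (intro lp_diff lp_sum K lp_scale edge lp_finite_support[OF K(1)])
       (simp_all add: K f)
  then show ?thesis
    using dom lp_finite_support[OF K] by (simp add: opA_dom_def)
qed

lemma finite_support_in_approx_dom:
  assumes edge: "\<And>y. (\<lambda>x. w x y / \<mu> x) \<in> lp \<mu> p"
    and f: "f 0 = 0" and K: "finite K" "\<And>x. x \<notin> K \<Longrightarrow> u x = 0"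
  shows "u \<in> approx_dom f"
proof -
  have dom: "u \<in> opA_dom w \<kappa> \<mu> f p" by (rule finite_support_in_opA_dom[where K=K]) (use edge f K in auto)
  define U where "U n = (if K \<subseteq> stage n then u else (\<lambda>x. 0))" for n
  define V where "V x = \<bar>u x\<bar> + \<bar>opA w \<kappa> \<mu> f u x\<bar>" for x
  have "eventually (\<lambda>n. \<forall>x\<in>K. x \<in> stage n) sequentially"
    using K(1) by (intro eventually_ball_finite ballI eventually_in_stage)
  then have ev: "eventually (\<lambda>n. U n = u) sequentially"
    by eventually_elim (auto simp: U_def)
  have "V \<in> lp \<mu> p"
    unfolding V_def using opA_dom_lp[OF dom] by (intro lp_add lp_abs)
  moreover have "\<forall>n x. x \<notin> stage n \<longrightarrow> U n x = 0"
    using K(2) by (auto simp: U_def)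
  moreover have "\<forall>n x. \<bar>U n x\<bar> \<le> V x" "\<forall>n. \<forall>x\<in>stage n. \<bar>opA w \<kappa> \<mu> f (U n) x\<bar> \<le> V x"
    by (auto simp: U_def V_def opA_zero[of f, OF f])
  moreover have "(\<lambda>n. U n x) \<longlonglongrightarrow> u x"
    "(\<lambda>n. opA w \<kappa> \<mu> f (U n) x) \<longlonglongrightarrow> opA w \<kappa> \<mu> f u x" for x
    by (rule tendsto_eventually; use ev in eventually_elim; simp)+
  ultimately show ?thesis
    unfolding approx_dom_def using dom by blast
qed

lemma approx_dom_dense:
  assumes edge: "\<And>y. (\<lambda>x. w x y / \<mu> x) \<in> lp \<mu> p"
    and f: "f 0 = 0"
  shows "lp_dense_in \<mu> p (approx_dom f) (lp \<mu> p)"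
  unfolding lp_dense_in_def
proof (intro conjI ballI allI impI)
  show "approx_dom f \<subseteq> lp \<mu> p"
    using approx_dom_subset opA_dom_lp by blast
  fix u and e :: real assume u: "u \<in> lp \<mu> p" and e: "0 < e"
  define T where "T n x = (if x \<in> stage n then u x else 0)" for n x
  have "(\<lambda>n. lp_norm \<mu> p (\<lambda>x. u x - T n x)) \<longlonglongrightarrow> lp_norm \<mu> p (\<lambda>x. 0)"
  proof (rule lp_norm_tendsto[OF lp_abs[OF u]])
    show "\<bar>u x - T n x\<bar> \<le> \<bar>u x\<bar>" for n x by (simp add: T_def)
    show "(\<lambda>n. u x - T n x) \<longlonglongrightarrow> 0" for x
      by (rule tendsto_eventually) (use eventually_in_stage[of x] in eventually_elim, simp add: T_def)
  qed
  then have "eventually (\<lambda>n. lp_norm \<mu> p (\<lambda>x. u x - T n x) < e) sequentially"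
    using e by (intro order_tendstoD(2)[where y="lp_norm \<mu> p (\<lambda>x. 0)"]) (simp_all add: lp_norm_zero)
  then obtain n where "lp_norm \<mu> p (\<lambda>x. u x - T n x) < e"
    by (auto simp: eventually_sequentially)
  moreover have "T n \<in> approx_dom f"
    by (rule finite_support_in_approx_dom[where K="stage n"]) (use edge f in \<open>auto simp: T_def finite_stage\<close>)
  ultimately show "\<exists>v\<in>approx_dom f. lp_norm \<mu> p (\<lambda>x. u x - v x) < e" by blast
qed

section \<open>Existence and uniqueness of solutions\<close>

text \<open>The Dirichlet solutions \<open>Vn n\<close> increase by the maximum principle, and the norm estimate bounds them
  in \<open>\<ell>\<^sup>p\<close>. The limit lies in the domain of the Laplacian because the equation expresses the sum over the
  neighbours through the value at the node itself, which stays bounded.\<close>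

lemma linear_resolvent:
  assumes t: "0 < t" "t * \<omega> < 1" and \<omega>: "0 \<le> \<omega>" and g: "g \<in> lp \<mu> p"
  obtains V Vn where "V \<in> lp \<mu> p" "V \<in> lap_dom w" "\<And>x. comparison_op \<omega> t V x = \<bar>g x\<bar>"
    "\<And>n x. x \<notin> stage n \<Longrightarrow> Vn n x = 0" "\<And>n x. x \<in> stage n \<Longrightarrow> comparison_op \<omega> t (Vn n) x = \<bar>g x\<bar>"
    "\<And>n x. 0 \<le> Vn n x" "\<And>n x. Vn n x \<le> V x" "\<And>x. (\<lambda>n. Vn n x) \<longlonglongrightarrow> V x"
proof -
  define c where "c = 1 - t * \<omega>"
  have c: "0 < c" using t by (simp add: c_def)
  note lin = reaction_linear[OF \<omega>]
  have "\<forall>n. \<exists>u. (\<forall>x. x \<notin> stage n \<longrightarrow> u x = 0) \<and> (\<forall>x\<in>stage n. comparison_op \<omega> t u x = \<bar>g x\<bar>)"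
    unfolding comparison_op_def by (intro allI dirichlet_problem_solvable[OF finite_stage lin t])
  then obtain Vn where off: "\<And>n x. x \<notin> stage n \<Longrightarrow> Vn n x = 0"
    and on: "\<And>n x. x \<in> stage n \<Longrightarrow> comparison_op \<omega> t (Vn n) x = \<bar>g x\<bar>"
    by metis
  have dom: "Vn n \<in> lap_dom w" for n
    by (rule lap_dom_finite_support[OF finite_stage off])
  have pos: "0 \<le> Vn n x" for n x
    by (rule comparison_op_monotone[OF finite_stage[of n] t \<omega> zero_in_lap_dom dom])
       (auto simp: comparison_op_zero on off)
  have mono: "Vn m x \<le> Vn n x" if "m \<le> n" for m n x
    by (rule comparison_op_monotone[OF finite_stage[of m] t \<omega> dom dom])
       (use stage_mono[OF that] in \<open>auto simp: on off pos\<close>)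
  have norm: "lp_norm \<mu> p (Vn n) \<le> lp_norm \<mu> p g / c" for n
  proof -
    have "c * lp_norm \<mu> p (Vn n) \<le> lp_norm \<mu> p (\<lambda>x. if x \<in> stage n then comparison_op \<omega> t (Vn n) x else 0)"
      using dirichlet_estimate[OF finite_stage lin t, of n "Vn n" "\<lambda>x. 0"] off
      by (simp add: c_def comparison_op_def opA_zero cong: if_cong)
    also have "\<dots> \<le> lp_norm \<mu> p g"
      by (rule lp_norm_mono[OF g]) (simp add: on)
    finally show ?thesis using c by (simp add: field_simps)
  qed
  define B where "B = lp_norm \<mu> p g / c"
  have lpn: "Vn n \<in> lp \<mu> p" for n
    by (rule lp_finite_support[OF finite_stage off])
  have bounded: "Vn n x \<le> (B powr p / \<mu> x) powr (1 / p)" for n x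
  proof -
    have "Vn n x powr p * \<mu> x \<le> lp_norm \<mu> p (Vn n) powr p"
      using lp_coordinate_bound[OF lpn, of n x] pos by simp
    also have "\<dots> \<le> B powr p"
      using norm[of n] lp_norm_nonneg p_ge_1 unfolding B_def by (intro powr_mono2) auto
    finally have "(Vn n x powr p) powr (1 / p) \<le> (B powr p / \<mu> x) powr (1 / p)"
      using \<mu>_pos[of x] p_ge_1 by (intro powr_mono2) (auto simp: field_simps)
    then show ?thesis using pos[of n x] p_ge_1 by (simp add: powr_powr)
  qed
  have "\<exists>l. (\<lambda>n. Vn n x) \<longlonglongrightarrow> l \<and> (\<forall>n. Vn n x \<le> l)" for x
    using incseq_convergent[of "\<lambda>n. Vn n x"] bounded[of _ x] mono[of _ _ x]
    by (metis incseq_def)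
  then obtain V where lim: "\<And>x. (\<lambda>n. Vn n x) \<longlonglongrightarrow> V x" and le: "\<And>n x. Vn n x \<le> V x"
    by metis
  have Vpos: "0 \<le> V x" for x using pos[of 0 x] le[of 0 x] by simp
  have Vlp: "V \<in> lp \<mu> p"
    by (rule lp_fatou[OF lpn norm lim])
  have Vdom: "V \<in> lap_dom w"
    unfolding lap_dom_def mem_Collect_eq
  proof
    fix x
    define C where "C = \<mu> x / t * ((c + t * (wdeg w x + \<kappa> x) / \<mu> x) * V x)"
    have "(\<Sum>y\<in>F. w x y * V y) \<le> C" if F: "finite F" for F
    proof (rule LIMSEQ_le_const2)
      show "(\<lambda>n. \<Sum>y\<in>F. w x y * Vn n y) \<longlonglongrightarrow> (\<Sum>y\<in>F. w x y * V y)"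
        by (intro tendsto_sum tendsto_mult tendsto_const lim)
      have "eventually (\<lambda>n. (\<Sum>y\<in>F. w x y * Vn n y) \<le> C) sequentially"
        using eventually_in_stage[of x]
      proof eventually_elim
        case (elim n)
        have "0 \<le> comparison_op \<omega> t (Vn n) x" using on[OF elim] by simp
        then have "t / \<mu> x * (\<Sum>\<^sub>\<infinity>y. w x y * Vn n y) \<le> (c + t * (wdeg w x + \<kappa> x) / \<mu> x) * Vn n x"
          by (simp add: comparison_op_eq[OF dom] c_def)
        also have "\<dots> \<le> (c + t * (wdeg w x + \<kappa> x) / \<mu> x) * V x"
          using c t wdeg_nonneg[of x] \<kappa>_nonneg[of x] \<mu>_pos[of x] le[of n x]
          by (intro mult_left_mono) auto
        finally have "\<mu> x / t * (t / \<mu> x * (\<Sum>\<^sub>\<infinity>y. w x y * Vn n y)) \<le> C"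
          unfolding C_def using t \<mu>_pos[of x] by (intro mult_left_mono) auto
        then have "(\<Sum>\<^sub>\<infinity>y. w x y * Vn n y) \<le> C"
          using t \<mu>_pos[of x] by simp
        moreover have "(\<Sum>y\<in>F. w x y * Vn n y) \<le> (\<Sum>\<^sub>\<infinity>y. w x y * Vn n y)"
          by (rule finite_sum_le_infsum)
             (use F lap_dom_summable[OF dom] pos w_nonneg in auto)
        ultimately show ?case by linarith
      qed
      then show "\<exists>N. \<forall>n\<ge>N. (\<Sum>y\<in>F. w x y * Vn n y) \<le> C"
        by (simp add: eventually_sequentially)
    qed
    then show "(\<lambda>y. w x y * \<bar>V y\<bar>) summable_on UNIV"
      using Vpos w_nonneg by (intro nonneg_bdd_above_summable_on bdd_aboveI2[where M=C]) auto
  qed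
  have "comparison_op \<omega> t V x = \<bar>g x\<bar>" for x
  proof (rule LIMSEQ_unique)
    show "(\<lambda>n. comparison_op \<omega> t (Vn n) x) \<longlonglongrightarrow> comparison_op \<omega> t V x"
      unfolding comparison_op_def
      by (intro tendsto_add tendsto_mult tendsto_const lim opA_tendsto[OF Vdom])
         (use pos le in \<open>auto intro: continuous_intros\<close>)
    show "(\<lambda>n. comparison_op \<omega> t (Vn n) x) \<longlonglongrightarrow> \<bar>g x\<bar>"
      by (rule tendsto_eventually) (use eventually_in_stage[of x] in eventually_elim, simp add: on)
  qed
  then show ?thesis
    using that[of V Vn] Vlp Vdom off on pos le lim by blast
qed

text \<open>The linear problem with data \<open>\<bar>g\<bar>\<close> dominates the Dirichlet solutions \<open>U n\<close> and also, through
  \<open>V - Vn n\<close>, their differences; see \<open>UV\<close> and \<open>cauchy\<close> in the proof.\<close>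

lemma resolvent_equation_solvable:
  assumes f: "reaction \<omega> f" and t: "0 < t" "t * \<omega> < 1" and g: "g \<in> lp \<mu> p"
  obtains u where "u \<in> approx_dom f" "solves w \<kappa> \<mu> f t g u"
    "(\<forall>x. 0 \<le> g x) \<Longrightarrow> (\<forall>x. 0 \<le> u x)" "(\<forall>x. g x \<le> 0) \<Longrightarrow> (\<forall>x. u x \<le> 0)"
proof -
  have \<omega>: "0 \<le> \<omega>" and f0: "f 0 = 0" and fc: "continuous_on UNIV f"
    using f by (auto simp: reaction_def)
  obtain V Vn where V: "V \<in> lp \<mu> p" "V \<in> lap_dom w" "\<And>x. comparison_op \<omega> t V x = \<bar>g x\<bar>"
    and Vn: "\<And>n x. x \<notin> stage n \<Longrightarrow> Vn n x = 0"
      "\<And>n x. x \<in> stage n \<Longrightarrow> comparison_op \<omega> t (Vn n) x = \<bar>g x\<bar>"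
      "\<And>n x. 0 \<le> Vn n x" "\<And>n x. Vn n x \<le> V x" "\<And>x. (\<lambda>n. Vn n x) \<longlonglongrightarrow> V x"
    using linear_resolvent[OF t \<omega> g] by blast
  have Vpos: "0 \<le> V x" for x using Vn(3)[of 0 x] Vn(4)[of 0 x] by simp
  have "\<forall>n. \<exists>u. (\<forall>x. x \<notin> stage n \<longrightarrow> u x = 0) \<and> (\<forall>x\<in>stage n. u x + t * opA w \<kappa> \<mu> f u x = g x)"
    by (intro allI dirichlet_problem_solvable[OF finite_stage f t])
  then obtain U where off: "\<And>n x. x \<notin> stage n \<Longrightarrow> U n x = 0"
    and on: "\<And>n x. x \<in> stage n \<Longrightarrow> U n x + t * opA w \<kappa> \<mu> f (U n) x = g x"
    by metis
  have dom: "U n \<in> lap_dom w" "Vn n \<in> lap_dom w" for n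
    by (rule lap_dom_finite_support[OF finite_stage[of n]]; use off Vn(1) in simp)+
  have UV: "\<bar>U n x\<bar> \<le> V x" for n x
  proof -
    have "\<bar>U n x\<bar> \<le> Vn n x"
    proof (rule comparison_op_monotone[OF finite_stage[of n] t \<omega> lap_dom_abs[OF dom(1)] dom(2)])
      fix y :: 'a assume "y \<in> stage n"
      then show "comparison_op \<omega> t (\<lambda>x. \<bar>U n x\<bar>) y \<le> comparison_op \<omega> t (Vn n) y"
        using kato_inequality[OF f t(1) dom(1) zero_in_lap_dom, of n y]
        by (simp add: on Vn(2) opA_zero[of f, OF f0])
    qed (simp add: off Vn(1))
    then show ?thesis using Vn(4)[of n x] by simp
  qed
  \<comment> \<open>on \<open>stage n\<close> the comparison operator is nonpositive on the left-hand side and zero on the right-hand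
      side; off \<open>stage n\<close>, where \<open>U n\<close> and \<open>Vn n\<close> vanish, this is the bound \<open>UV\<close> for \<open>U m\<close>\<close>
  have cauchy: "\<bar>U m x - U n x\<bar> \<le> V x - Vn n x" if "n \<le> m" for m n x
  proof (rule comparison_op_monotone[OF finite_stage[of n] t \<omega>])
    show "(\<lambda>x. \<bar>U m x - U n x\<bar>) \<in> lap_dom w" "(\<lambda>x. V x - Vn n x) \<in> lap_dom w"
      by (intro lap_dom_abs lap_dom_diff dom V)+
    show "\<bar>U m x - U n x\<bar> \<le> V x - Vn n x" if "x \<notin> stage n" for x :: 'a
      using UV[of m x] that by (simp add: off Vn(1))
    fix x :: 'a assume x: "x \<in> stage n"
    then have "x \<in> stage m" using stage_mono[OF \<open>n \<le> m\<close>] by blast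
    then have "(U m x - U n x) + t * (opA w \<kappa> \<mu> f (U m) x - opA w \<kappa> \<mu> f (U n) x) = 0"
      using on[of x m] on[OF x] by (simp add: right_diff_distrib)
    then show "comparison_op \<omega> t (\<lambda>x. \<bar>U m x - U n x\<bar>) x \<le> comparison_op \<omega> t (\<lambda>x. V x - Vn n x) x"
      using kato_inequality[OF f t(1) dom(1) dom(1), of m n x] x
      by (simp add: comparison_op_diff[OF V(2) dom(2)] V(3) Vn(2))
  qed
  have "convergent (\<lambda>n. U n x)" for x
  proof (rule real_Cauchy_convergent, rule CauchyI')
    fix e :: real assume e: "0 < e"
    then obtain N where N: "\<And>n. N \<le> n \<Longrightarrow> \<bar>Vn n x - V x\<bar> < e"
      using LIMSEQ_D[OF Vn(5)[of x] e] by auto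
    have "dist (U m x) (U n x) < e" if "N \<le> m" "m < n" for m n
      using cauchy[of m n x] N[OF that(1)] that by (simp add: dist_real_def abs_minus_commute)
    then show "\<exists>M. \<forall>m\<ge>M. \<forall>n>m. dist (U m x) (U n x) < e" by blast
  qed
  then obtain u where lim: "\<And>x. (\<lambda>n. U n x) \<longlonglongrightarrow> u x"
    unfolding convergent_def by metis
  have uV: "\<bar>u x\<bar> \<le> \<bar>V x\<bar>" for x
    using LIMSEQ_le_const2[OF tendsto_rabs[OF lim[of x]], of "V x"] UV Vpos[of x] by auto
  have udom: "u \<in> lap_dom w" and ulp: "u \<in> lp \<mu> p"
    by (rule lap_dom_dominated[OF V(2) uV], rule lp_dominated[OF V(1) uV])
  have opA_lim: "(\<lambda>n. opA w \<kappa> \<mu> f (U n) x) \<longlonglongrightarrow> opA w \<kappa> \<mu> f u x" for x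
    by (rule opA_tendsto[OF V(2) UV lim fc])
  have eq: "u x + t * opA w \<kappa> \<mu> f u x = g x" for x
  proof (rule LIMSEQ_unique)
    show "(\<lambda>n. U n x + t * opA w \<kappa> \<mu> f (U n) x) \<longlonglongrightarrow> u x + t * opA w \<kappa> \<mu> f u x"
      by (intro tendsto_add tendsto_mult tendsto_const lim opA_lim)
    show "(\<lambda>n. U n x + t * opA w \<kappa> \<mu> f (U n) x) \<longlonglongrightarrow> g x"
      by (rule tendsto_eventually) (use eventually_in_stage[of x] in eventually_elim, simp add: on)
  qed
  have "opA w \<kappa> \<mu> f u x = 1 / t * (g x - u x)" for x
    using eq[of x] t by (simp add: field_simps)
  then have "opA w \<kappa> \<mu> f u = (\<lambda>x. 1 / t * (g x - u x))" by blast
  then have "opA w \<kappa> \<mu> f u \<in> lp \<mu> p"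
    by (simp only:) (intro lp_scale lp_diff g ulp)
  then have uA: "u \<in> opA_dom w \<kappa> \<mu> f p"
    using udom ulp by (simp add: opA_dom_def)
  define D where "D x = V x + 1 / t * (\<bar>g x\<bar> + V x)" for x
  have "D \<in> lp \<mu> p" unfolding D_def by (intro lp_add lp_scale lp_abs g V)
  moreover have "\<bar>U n x\<bar> \<le> D x" for n x
    using UV[of n x] Vpos[of x] t by (simp add: D_def add_increasing2)
  moreover have "\<bar>opA w \<kappa> \<mu> f (U n) x\<bar> \<le> D x" if "x \<in> stage n" for n x
  proof -
    have "opA w \<kappa> \<mu> f (U n) x = 1 / t * (g x - U n x)"
      using on[OF that] t by (simp add: field_simps)
    then have "\<bar>opA w \<kappa> \<mu> f (U n) x\<bar> = 1 / t * \<bar>g x - U n x\<bar>"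
      using t by (simp add: abs_mult)
    also have "\<dots> \<le> 1 / t * (\<bar>g x\<bar> + V x)"
      using t UV[of n x] by (intro mult_left_mono) auto
    finally show ?thesis using Vpos[of x] by (simp add: D_def)
  qed
  ultimately have "u \<in> approx_dom f"
    unfolding approx_dom_def using uA off lim opA_lim by blast
  moreover have "solves w \<kappa> \<mu> f t g u"
    using udom eq by (simp add: solves_def)
  moreover have "0 \<le> u x" if "\<forall>x. 0 \<le> g x" for x
  proof -
    have "0 \<le> U n x" for n
      by (rule comparison_principle[OF finite_stage[of n] f t zero_in_lap_dom dom(1)])
         (use that in \<open>auto simp: on off opA_zero[of f, OF f0]\<close>)
    then show ?thesis by (intro LIMSEQ_le_const[OF lim]) blast
  qed
  moreover have "u x \<le> 0" if "\<forall>x. g x \<le> 0" for x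
  proof -
    have "U n x \<le> 0" for n
      by (rule comparison_principle[OF finite_stage[of n] f t dom(1) zero_in_lap_dom])
         (use that in \<open>auto simp: on off opA_zero[of f, OF f0]\<close>)
    then show ?thesis by (intro LIMSEQ_le_const2[OF lim]) blast
  qed
  ultimately show ?thesis using that by blast
qed

lemma approx_dom_unique:
  assumes f: "reaction \<omega> f" and t: "0 < t" "t * \<omega> < 1"
    and u: "u \<in> approx_dom f" "solves w \<kappa> \<mu> f t g u" and v: "v \<in> approx_dom f" "solves w \<kappa> \<mu> f t g v"
  shows "v = u"
proof
  fix x
  have "(v x - u x) + t * (opA w \<kappa> \<mu> f v x - opA w \<kappa> \<mu> f u x) = 0" for x
    using u(2) v(2) by (simp add: solves_def algebra_simps)
  then have "(1 - t * \<omega>) * lp_norm \<mu> p (\<lambda>x. v x - u x) \<le> 0"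
    using accretive_estimate[OF f t v(1) u(1)] by (simp add: lp_norm_zero)
  then have "lp_norm \<mu> p (\<lambda>x. v x - u x) \<le> 0"
    using t by (simp add: mult_le_0_iff)
  moreover have "(\<lambda>x. v x - u x) \<in> lp \<mu> p"
    using u(1) v(1) approx_dom_subset opA_dom_lp(1) by (intro lp_diff) blast+
  ultimately show "v x = u x" using lp_norm_eq_0 by fastforce
qed

lemma approx_dom_solution_bound:
  assumes f: "reaction \<omega> f" and t: "0 < t" "t * \<omega> < 1"
    and u: "u \<in> approx_dom f" "solves w \<kappa> \<mu> f t g u"
  shows "lp_norm \<mu> p u \<le> 1 / (1 - t * \<omega>) * lp_norm \<mu> p g"
proof -
  have f0: "f 0 = 0" using f by (simp add: reaction_def)
  have A0: "opA w \<kappa> \<mu> f (\<lambda>x. 0) = (\<lambda>x. 0)"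
    by (rule ext) (rule opA_zero[of f, OF f0])
  have "(\<lambda>x. 0) \<in> approx_dom f"
    using lp_finite_support[of "{}" "\<lambda>x. 0"] zero_in_lap_dom
    unfolding approx_dom_def opA_dom_def
    by (auto simp: A0 intro!: exI[of _ "\<lambda>n x. 0"] exI[of _ "\<lambda>x. 0"])
  from accretive_estimate[OF f t u(1) this]
  have "(1 - t * \<omega>) * lp_norm \<mu> p u \<le> lp_norm \<mu> p g"
    using u(2) by (simp add: solves_def opA_zero[of f, OF f0])
  then show ?thesis using t by (simp add: field_simps)
qed

section \<open>Injectivity on the maximal domain\<close>

text \<open>The comparison operator sends \<open>h = \<bar>u - v\<bar>\<close> to a nonpositive function. Under (B) the weighted degree is
  at most a multiple of \<open>\<mu>\<close>, and the norm estimate applies to \<open>h\<close>. Under (IP) a node with \<open>h > 0\<close> must have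
  a neighbour with a larger value; iterating gives an infinite path along which \<open>h\<close> is bounded below by a positive
  constant, so that \<open>h \<in> \<ell>\<^sup>p\<close> makes \<open>\<mu>\<close> summable along it.\<close>

lemma resolvent_injective:
  assumes cond: "cond_IP w \<mu> \<or> cond_B w \<mu>"
    and f: "reaction \<omega> f" and t: "0 < t" "t * \<omega> < 1"
    and u: "u \<in> opA_dom w \<kappa> \<mu> f p" and v: "v \<in> opA_dom w \<kappa> \<mu> f p"
    and eq: "\<And>x. u x + t * opA w \<kappa> \<mu> f u x = v x + t * opA w \<kappa> \<mu> f v x"
  shows "u = v"
proof -
  define h where "h x = \<bar>u x - v x\<bar>" for x
  have hdom: "h \<in> lap_dom w" and hlp: "h \<in> lp \<mu> p"
    unfolding h_def using opA_dom_lp[OF u] opA_dom_lp[OF v]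
    by (auto intro!: lap_dom_abs lap_dom_diff lp_abs lp_diff)
  have h0: "0 \<le> h x" for x by (simp add: h_def)
  have sub: "comparison_op \<omega> t h x \<le> 0" for x
  proof -
    have "(u x - v x) + t * (opA w \<kappa> \<mu> f u x - opA w \<kappa> \<mu> f v x) = 0"
      using eq[of x] by (simp add: right_diff_distrib)
    then show ?thesis
      using kato_inequality[OF f t(1) opA_dom_lp(3)[OF u] opA_dom_lp(3)[OF v], of x]
      by (simp add: h_def[abs_def])
  qed
  have "h x = 0" for x
    using cond
  proof
    assume "cond_B w \<mu>"
    then obtain M where M: "\<And>x. wdeg w x / \<mu> x \<le> M"
      by (auto simp: cond_B_def bdd_above_def wdeg_def)
    have "(\<lambda>x. wdeg w x * h x powr p) summable_on UNIV"
    proof (rule summable_on_comparison_test)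
      show "(\<lambda>x. M * (h x powr p * \<mu> x)) summable_on UNIV"
        using hlp h0 by (intro summable_on_cmult_right) (simp add: lp_def)
      show "wdeg w x * h x powr p \<le> M * (h x powr p * \<mu> x)" for x
        using mult_right_mono[OF M[of x], of "h x powr p * \<mu> x"] \<mu>_pos[of x] by simp
    qed (simp add: wdeg_nonneg)
    then have "(1 - t * \<omega>) * lp_norm \<mu> p h \<le> lp_norm \<mu> p (\<lambda>x. 0)"
      using hlp hdom h0 sub lp_finite_support[of "{}" "\<lambda>x. 0"]
      by (intro lp_norm_le_if_comparison_op_le[OF t]) auto
    then have "lp_norm \<mu> p h \<le> 0"
      using t by (simp add: lp_norm_zero mult_le_0_iff)
    then show "h x = 0" by (rule lp_norm_eq_0[OF hlp])
  next
    assume IP: "cond_IP w \<mu>"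
    have step: "\<exists>y. adj w x y \<and> h x < h y" if hx: "0 < h x" for x
    proof (rule ccontr)
      assume no: "\<not> (\<exists>y. adj w x y \<and> h x < h y)"
      have "(\<Sum>\<^sub>\<infinity>y. w x y * h y) \<le> (\<Sum>\<^sub>\<infinity>y. w x y * h x)"
      proof (rule infsum_mono)
        show "w x y * h y \<le> w x y * h x" for y
        proof (cases "w x y = 0")
          case False
          then have "adj w x y" using w_nonneg[of x y] by (simp add: adj_def)
          then have "h y \<le> h x" using no by (simp add: not_less)
          then show ?thesis by (rule mult_left_mono) (rule w_nonneg)
        qed simp
      qed (intro lap_dom_summable[OF hdom] summable_on_cmult_left w_summable)+
      also have "\<dots> = wdeg w x * h x" by (simp add: infsum_cmult_left' wdeg_def)
      finally have "t / \<mu> x * (\<Sum>\<^sub>\<infinity>y. w x y * h y) \<le> t / \<mu> x * (wdeg w x * h x)"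
        using t \<mu>_pos[of x] by (intro mult_left_mono) auto
      moreover have "0 \<le> t / \<mu> x * (\<kappa> x * h x)"
        using t \<mu>_pos[of x] \<kappa>_nonneg[of x] hx by simp
      moreover have "comparison_op \<omega> t h x = (1 - t * \<omega>) * h x + t / \<mu> x * (wdeg w x * h x)
          + t / \<mu> x * (\<kappa> x * h x) - t / \<mu> x * (\<Sum>\<^sub>\<infinity>y. w x y * h y)"
        unfolding comparison_op_eq[OF hdom] using \<mu>_pos[of x] by (simp add: field_simps)
      moreover have "0 < (1 - t * \<omega>) * h x" using t hx by simp
      ultimately show False using sub[of x] by linarith
    qed
    show "h x = 0"
    proof (rule ccontr)
      assume "h x \<noteq> 0"
      then have hx: "0 < h x" using h0[of x] by simp
      obtain z where z: "\<And>n. h x \<le> h (z n) \<and> adj w (z n) (z (Suc n)) \<and> h (z n) < h (z (Suc n))"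
      proof -
        have "\<exists>z. \<forall>n. h x \<le> h (z n) \<and> (adj w (z n) (z (Suc n)) \<and> h (z n) < h (z (Suc n)))"
        proof (rule dependent_nat_choice[where P="\<lambda>n y. h x \<le> h y"
              and Q="\<lambda>n y y'. adj w y y' \<and> h y < h y'"])
          show "\<exists>y. h x \<le> h y" by blast
          fix y n assume y: "h x \<le> h y"
          then have "0 < h y" using hx by simp
          from step[OF this] show "\<exists>y'. h x \<le> h y' \<and> adj w y y' \<and> h y < h y'"
            using y by (meson less_imp_le order_trans)
        qed
        then show ?thesis using that by blast
      qed
      have "strict_mono (\<lambda>n. h (z n))" using z by (simp add: strict_mono_Suc_iff)
      then have "inj z" by (metis injI strict_mono_eq)
      then have path: "infinite_path w z" using z by (simp add: infinite_path_def)
      have "(\<lambda>x. h x powr p * \<mu> x) summable_on UNIV"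
        using hlp h0 by (simp add: lp_def)
      then have "(\<lambda>x. h x powr p * \<mu> x) summable_on range z"
        by (rule summable_on_subset_banach) simp
      then have "(\<lambda>n. h (z n) powr p * \<mu> (z n)) summable_on UNIV"
        using summable_on_reindex[OF \<open>inj z\<close>, of "\<lambda>x. h x powr p * \<mu> x"] by (simp add: o_def)
      then have "summable (\<lambda>n. h (z n) powr p * \<mu> (z n))"
        by (rule summable_on_imp_summable)
      then have dominating: "summable (\<lambda>n. 1 / (h x powr p) * (h (z n) powr p * \<mu> (z n)))"
        by (rule summable_mult)
      have "norm (\<mu> (z n)) \<le> 1 / (h x powr p) * (h (z n) powr p * \<mu> (z n))" for n
      proof -
        have "h x powr p * \<mu> (z n) \<le> h (z n) powr p * \<mu> (z n)"
          using z[of n] hx p_ge_1 \<mu>_pos[of "z n"] by (intro mult_right_mono powr_mono2) auto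
        then show ?thesis using hx \<mu>_pos[of "z n"] by (simp add: field_simps)
      qed
      then have "summable (\<lambda>n. \<mu> (z n))"
        by (intro summable_comparison_test'[OF dominating])
      then show False using IP path by (simp add: cond_IP_def)
    qed
  qed
  then show ?thesis by (auto simp: h_def)
qed

text \<open>Any \<open>t\<close> with \<open>t * \<omega> < 1\<close> serves: the solution in \<open>approx_dom f\<close> with right-hand side \<open>u + t A u\<close> is \<open>u\<close>.\<close>

lemma approx_dom_eq_opA_dom:
  assumes cond: "cond_IP w \<mu> \<or> cond_B w \<mu>" and f: "reaction \<omega> f"
  shows "approx_dom f = opA_dom w \<kappa> \<mu> f p"
proof
  show "opA_dom w \<kappa> \<mu> f p \<subseteq> approx_dom f"
  proof
    fix u assume u: "u \<in> opA_dom w \<kappa> \<mu> f p"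
    have \<omega>: "0 \<le> \<omega>" using f by (simp add: reaction_def)
    define t where "t = 1 / (\<omega> + 1)"
    have t: "0 < t" "t * \<omega> < 1" using \<omega> by (simp_all add: t_def)
    define g where "g x = u x + t * opA w \<kappa> \<mu> f u x" for x
    have "g \<in> lp \<mu> p"
      unfolding g_def using opA_dom_lp[OF u] by (intro lp_add lp_scale)
    then obtain v where v: "v \<in> approx_dom f" "solves w \<kappa> \<mu> f t g v"
      using resolvent_equation_solvable[OF f t] by blast
    have "u = v"
      using v approx_dom_subset
      by (intro resolvent_injective[OF cond f t u]) (auto simp: solves_def g_def)
    then show "u \<in> approx_dom f" using v by simp
  qed
qed (rule approx_dom_subset)

lemma unique_solution_in_approx_dom:
  assumes f: "reaction \<omega> f" and t: "0 < t" "t * \<omega> < 1" and g: "g \<in> lp \<mu> p"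
    and M: "1 / (1 - t * \<omega>) * lp_norm \<mu> p g \<le> M"
  shows "\<exists>u. unique_solution w \<kappa> \<mu> f p t g (approx_dom f) M u \<and>
    ((\<forall>x. 0 \<le> g x) \<longrightarrow> (\<forall>x. 0 \<le> u x)) \<and> ((\<forall>x. g x \<le> 0) \<longrightarrow> (\<forall>x. u x \<le> 0))"
proof -
  obtain u where u: "u \<in> approx_dom f" "solves w \<kappa> \<mu> f t g u"
    and sign: "(\<forall>x. 0 \<le> g x) \<Longrightarrow> (\<forall>x. 0 \<le> u x)" "(\<forall>x. g x \<le> 0) \<Longrightarrow> (\<forall>x. u x \<le> 0)"
    using resolvent_equation_solvable[OF f t g] by blast
  have "unique_solution w \<kappa> \<mu> f p t g (approx_dom f) M u"
    unfolding unique_solution_def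
    by (intro conjI ballI impI u approx_dom_unique[OF f t u]
        order_trans[OF approx_dom_solution_bound[OF f t u] M])
  then show ?thesis using sign by blast
qed

lemma unique_solution_of_given_sign:
  assumes f: "reaction \<omega> f" and t: "0 < t" "t * \<omega> < 1"
    and S: "S \<in> {lp_pos \<mu> p, lp_neg \<mu> p}" and g: "g \<in> S"
  shows "\<exists>u. unique_solution w \<kappa> \<mu> f p t g (S \<inter> approx_dom f) (1 / (1 - t * \<omega>) * lp_norm \<mu> p g) u"
proof -
  have neg: "lp_neg \<mu> p = {u \<in> lp \<mu> p. \<forall>x. u x \<le> 0}"
  proof (intro set_eqI iffI)
    fix u assume "u \<in> lp_neg \<mu> p"
    then show "u \<in> {u \<in> lp \<mu> p. \<forall>x. u x \<le> 0}" by (auto simp: lp_neg_def lp_pos_def lp_def)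
  next
    fix u assume "u \<in> {u \<in> lp \<mu> p. \<forall>x. u x \<le> 0}"
    then have "- u \<in> lp_pos \<mu> p" by (auto simp: lp_pos_def lp_def)
    then show "u \<in> lp_neg \<mu> p" unfolding lp_neg_def by (intro image_eqI[where x="- u"]) (simp_all add: fun_eq_iff)
  qed
  have glp: "g \<in> lp \<mu> p" using S g by (auto simp: neg lp_pos_def)
  obtain u where u: "unique_solution w \<kappa> \<mu> f p t g (approx_dom f) (1 / (1 - t * \<omega>) * lp_norm \<mu> p g) u"
    "(\<forall>x. 0 \<le> g x) \<longrightarrow> (\<forall>x. 0 \<le> u x)" "(\<forall>x. g x \<le> 0) \<longrightarrow> (\<forall>x. u x \<le> 0)"
    using unique_solution_in_approx_dom[OF f t glp order_refl] by blast
  have "u \<in> lp \<mu> p"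
    using u(1) approx_dom_subset opA_dom_lp(1) unfolding unique_solution_def by blast
  then have "u \<in> S" using S g u(2,3) by (auto simp: neg lp_pos_def)
  then show ?thesis using u(1) by (auto simp: unique_solution_def)
qed

end

section \<open>Accretivity and solvability of the graph reaction-diffusion operator\<close>

theorem theorem4p1:
  fixes w :: "'a::countable \<Rightarrow> 'a \<Rightarrow> real"
    and \<kappa> \<mu> :: "'a \<Rightarrow> real"
    and p :: real
    and f :: "real \<Rightarrow> real"
  assumes graph: "weighted_graph w \<kappa> \<mu>"
    and conn: "connected_graph w"
    and p1: "1 \<le> p"
    and wp: "p > 1 \<Longrightarrow> \<forall>x. (\<lambda>y. w x y powr p / \<mu> y powr (p - 1)) summable_on UNIV"
    and F: "cond_F1 f \<or> (\<exists>L. cond_F2 L f)"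
  shows "\<exists>\<Omega>. \<Omega> \<subseteq> opA_dom w \<kappa> \<mu> f p \<and> lp_dense_in \<mu> p \<Omega> (lp \<mu> p) \<and>
    (cond_F1 f \<longrightarrow> lp_accretive \<mu> p \<Omega> (opA w \<kappa> \<mu> f)) \<and>
    (\<forall>L. cond_F2 L f \<longrightarrow> lp_omega_accretive L \<mu> p \<Omega> (opA w \<kappa> \<mu> f)) \<and>
    (\<forall>S\<in>{lp_pos \<mu> p, lp_neg \<mu> p}.
       (cond_F1 f \<longrightarrow> (\<forall>t>0. \<forall>g\<in>S. \<exists>u.
          unique_solution w \<kappa> \<mu> f p t g (S \<inter> \<Omega>) (1 * lp_norm \<mu> p g) u)) \<and>
       (\<forall>L. cond_F2 L f \<longrightarrow> (\<forall>t\<in>{0<..<1 / L}. \<forall>g\<in>S. \<exists>u.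
          unique_solution w \<kappa> \<mu> f p t g (S \<inter> \<Omega>) (1 / (1 - t * L) * lp_norm \<mu> p g) u))) \<and>
    (cond_IP w \<mu> \<or> cond_B w \<mu> \<longrightarrow>
       \<Omega> = opA_dom w \<kappa> \<mu> f p \<and>
       (cond_F1 f \<longrightarrow> (\<forall>t>0. \<forall>g\<in>lp \<mu> p. \<exists>u.
          unique_solution w \<kappa> \<mu> f p t g \<Omega>
            (2 powr ((p - 1) / p) * 1 * lp_norm \<mu> p g) u)) \<and>
       (\<forall>L. cond_F2 L f \<longrightarrow> (\<forall>t\<in>{0<..<1 / L}. \<forall>g\<in>lp \<mu> p. \<exists>u.
          unique_solution w \<kappa> \<mu> f p t g \<Omega>
            (2 powr ((p - 1) / p) * (1 / (1 - t * L)) * lp_norm \<mu> p g) u)))"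
proof -
  interpret lp_graph w \<kappa> \<mu> p
    using graph p1 by (simp add: lp_graph_def lp_graph_axioms_def)
  obtain \<omega> where f: "reaction \<omega> f"
    using F reaction_0_if_F1 reaction_if_F2 by blast
  then have f0: "f 0 = 0" by (simp add: reaction_def)
  have edge: "(\<lambda>x. w x y / \<mu> x) \<in> lp \<mu> p" for y
    by (rule edge_weights_in_lp) (use wp in blast)
  have two: "1 \<le> (2::real) powr ((p - 1) / p)"
    using p1 by (intro ge_one_powr_ge_zero) auto
  have small: "0 < t" "t * L < 1" "0 < 1 / (1 - t * L)" if "cond_F2 L f" "t \<in> {0<..<1 / L}" for t L
    using that by (auto simp: cond_F2_def field_simps)
  show ?thesis
  proof (intro exI[of _ "approx_dom f"] conjI impI allI ballI)
    show "approx_dom f \<subseteq> opA_dom w \<kappa> \<mu> f p" by (rule approx_dom_subset)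
    show "lp_dense_in \<mu> p (approx_dom f) (lp \<mu> p)" by (rule approx_dom_dense) (use edge f0 in auto)
    show "lp_accretive \<mu> p (approx_dom f) (opA w \<kappa> \<mu> f)" if "cond_F1 f"
      using omega_accretive[OF reaction_0_if_F1[OF that]] by (simp add: lp_omega_accretive_def)
    show "lp_omega_accretive L \<mu> p (approx_dom f) (opA w \<kappa> \<mu> f)" if "cond_F2 L f" for L
      by (rule omega_accretive[OF reaction_if_F2[OF that]])
    show "\<exists>u. unique_solution w \<kappa> \<mu> f p t g (S \<inter> approx_dom f) (1 * lp_norm \<mu> p g) u"
      if "S \<in> {lp_pos \<mu> p, lp_neg \<mu> p}" "cond_F1 f" "0 < t" "g \<in> S" for S t g
      using unique_solution_of_given_sign[OF reaction_0_if_F1 _ _ that(1,4), of f t] that by simp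
    show "\<exists>u. unique_solution w \<kappa> \<mu> f p t g (S \<inter> approx_dom f) (1 / (1 - t * L) * lp_norm \<mu> p g) u"
      if "S \<in> {lp_pos \<mu> p, lp_neg \<mu> p}" "cond_F2 L f" "t \<in> {0<..<1 / L}" "g \<in> S" for S L t g
      by (rule unique_solution_of_given_sign[OF reaction_if_F2[OF that(2)] small(1,2)[OF that(2,3)] that(1,4)])
    show "approx_dom f = opA_dom w \<kappa> \<mu> f p" if "cond_IP w \<mu> \<or> cond_B w \<mu>"
      by (rule approx_dom_eq_opA_dom[OF that f])
    show "\<exists>u. unique_solution w \<kappa> \<mu> f p t g (approx_dom f)
        (2 powr ((p - 1) / p) * 1 * lp_norm \<mu> p g) u"
      if "cond_F1 f" "0 < t" "g \<in> lp \<mu> p" for t g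
    proof -
      have "1 / (1 - t * 0) * lp_norm \<mu> p g \<le> 2 powr ((p - 1) / p) * 1 * lp_norm \<mu> p g"
        using mult_right_mono[OF two lp_norm_nonneg[of g]] by simp
      then show ?thesis
        using unique_solution_in_approx_dom[OF reaction_0_if_F1[OF that(1)] that(2) _ that(3)] by fastforce
    qed
    show "\<exists>u. unique_solution w \<kappa> \<mu> f p t g (approx_dom f)
        (2 powr ((p - 1) / p) * (1 / (1 - t * L)) * lp_norm \<mu> p g) u"
      if "cond_F2 L f" "t \<in> {0<..<1 / L}" "g \<in> lp \<mu> p" for L t g
    proof -
      have "1 / (1 - t * L) * lp_norm \<mu> p g
          \<le> 2 powr ((p - 1) / p) * (1 / (1 - t * L)) * lp_norm \<mu> p g"
        using mult_right_mono[OF two, of "1 / (1 - t * L) * lp_norm \<mu> p g"]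
          lp_norm_nonneg[of g] small(3)[OF that(1,2)] by (simp add: mult.assoc)
      then show ?thesis
        using unique_solution_in_approx_dom[OF reaction_if_F2[OF that(1)] small(1,2)[OF that(1,2)] that(3)]
        by blast
    qed
  qed
qed

end
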